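(* Let the formal vector field $\dot x=G(x)=\sum_{P\in M_\lambda}(x\odot G_P)x^P$ on $\mathbb C^n$ be in Poincaré-Dulac normal form, with $\lambda\neq0$ the vector of eigenvalues of its linear part, and let it be maximal formally meromorphic integrable. Let $\bar R_\lambda$ have basis $Q_1,\dots,Q_{n-r}$ (thus rank $n-r$), let $\lambda^{(1)},\dots,\lambda^{(r)}\in\mathbb C^n$ be linearly independent with all $\langle Q_i,\lambda^{(j)}\rangle=0$, and let $\lambda=\sum_{j=1}^r\gamma_j\lambda^{(j)}$ be the corresponding additive decomposition (so $\{\lambda^{(1)},\dots,\lambda^{(r)}\}$ is rational isoresonant with respect to $\lambda$, and $G$ is a linear combination of the $\lambda^{(j)}\odot x$ with formally meromorphic coefficients). (a) If this representation admits the exceptional index $j$, then entry number $j$ of every $Q_i$ is zero. In other words, every Laurent monomial first integral, and every formally meromorphic first integral, of $\dot x=G(x)$ is independent of $x_j$. (b) $G$ admits a representation $$G(x)=\sum_{i=1}^r(\gamma_i+\check s_i(x))\,\lambda^{(i)}\odot x$$ with formal power series coefficients $$\check s_i(x)=\sum_{P\in M_\lambda^+}\sigma_{i,P}x^P,\qquad \sigma_{i,P}\in\mathbb C,\quad \check s_i(0)=0,\quad i=1,\dots,r.$$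
   Context: $\odot$ is the componentwise product, $x^Q=x_1^{q_1}\cdots x_n^{q_n}$, $\langle Q,v\rangle=\sum q_iv_i$. $\mathbf N_i=\{Q\in\mathbb Z^n: q_i\ge -1,\ q_j\ge 0\ (j\ne i)\}$, $\mathbf N=\bigcup_i\mathbf N_i$. Every formal power series vector field is written uniquely as $\sum_{Q\in\mathbf N}(x\odot F_Q)x^Q$, $F_Q\in\mathbb C^n$ (the $i$-th entry of $F_Q$ being $0$ unless $Q\in\mathbf N_i$). The linear part of $G$ is a lower-triangular matrix in Jordan form with diagonal $\lambda$ and subdiagonal entries $\sigma_i\in\mathbb C$ (zero whenever $\lambda_i\neq\lambda_{i-1}$); vector fields vanish at $0$, $G_0=\lambda$. $M_\lambda=\{P\in\mathbf N:\langle P,\lambda\rangle=0\}$, $M_\lambda^+=\{P\in\mathbb Z^n_{\ge0}:\langle P,\lambda\rangle=0\}$, $\bar R_\lambda=\{P\in\mathbb Z^n:\langle P,\lambda\rangle=0\}$. Normal form means only terms with $P\in M_\lambda$ occur. Formally meromorphic functions are elements of the fraction field $\mathbb C((x_1,\dots,x_n))$ of $\mathbb C[[x_1,\dots,x_n]]$; a first integral is such a $\psi$ with $D\psi(x)G(x)=0$; independence means the Jacobian matrix has full rank over $\mathbb C((x_1,\dots,x_n))$. The system is maximal formally meromorphic integrable if it admits $d$ independent formally meromorphic first integrals, where $d=\operatorname{rank}\bar R_\lambda$. Rational isoresonant with respect to $\lambda$: for all $P\in\mathbb Z^n$, $\langle P,\lambda\rangle=0$ implies $\langle P,\lambda^{(j)}\rangle=0$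 for all $j$. Exceptional index: let $\Lambda$ be the $n\times r$ matrix with columns $\lambda^{(1)}\odot x,\dots,\lambda^{(r)}\odot x$ (rank $r$). An index $j$ is exceptional if the matrix obtained from $\Lambda$ by omitting row number $j$ has rank $<r$ (equivalently, the same holds for the constant matrix with columns $\lambda^{(1)},\dots,\lambda^{(r)}$). *)

theory Defs
  imports
    "HOL-Analysis.Cartesian_Space"
    "HOL-Computational_Algebra.Polynomial_Factorial"
begin

subsection \<open>Formal power series in finitely many variables\<close>

text \<open>
  The variables are indexed by a finite type \<open>'n\<close>; a monomial is given by its exponent vector
  in \<open>nat ^ 'n\<close>, and a series is the family of its coefficients.
\<close>

typedef ('a, 'n::finite) mfps = "UNIV :: ((nat ^ 'n) \<Rightarrow> 'a) set"
  morphisms mfps_nth Abs_mfps ..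

setup_lifting type_definition_mfps

lemma mfps_nth_Abs_mfps [simp]: "mfps_nth (Abs_mfps f) = f"
  by (simp add: Abs_mfps_inverse)

lemma mfps_eqI: "(\<And>P. mfps_nth f P = mfps_nth g P) \<Longrightarrow> f = g"
  by transfer auto

lemma mfps_eq_iff: "f = g \<longleftrightarrow> (\<forall>P. mfps_nth f P = mfps_nth g P)"
  using mfps_eqI by blast

definition splittings :: "(nat ^ 'n) \<Rightarrow> ((nat ^ 'n) \<times> (nat ^ 'n)) set" where
  "splittings P = {(A, B). A + B = P}"

lemma finite_vec_le: "finite {A :: nat ^ 'n::finite. \<forall>i. A $ i \<le> P $ i}"
proof -
  have "{A :: nat ^ 'n. \<forall>i. A $ i \<le> P $ i} \<subseteq> vec_lambda ` (PiE UNIV (\<lambda>i. {..P $ i}))"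
  proof
    fix A :: "nat ^ 'n"
    assume "A \<in> {A. \<forall>i. A $ i \<le> P $ i}"
    then have "vec_nth A \<in> PiE UNIV (\<lambda>i. {..P $ i})" by auto
    then show "A \<in> vec_lambda ` (PiE UNIV (\<lambda>i. {..P $ i}))"
      by (metis image_eqI vec_lambda_eta)
  qed
  then show ?thesis
    by (rule finite_subset) (intro finite_imageI finite_PiE; simp)
qed

lemma finite_splittings [simp]: "finite (splittings (P :: nat ^ 'n::finite))"
proof -
  have "splittings P \<subseteq> {A. \<forall>i. A $ i \<le> P $ i} \<times> {A. \<forall>i. A $ i \<le> P $ i}"
    by (auto simp: splittings_def)
  then show ?thesis
    by (rule finite_subset) (intro finite_cartesian_product finite_vec_le)
qed

lemma mem_splittings [simp]: "(A, B) \<in> splittings P \<longleftrightarrow> A + B = P"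
  by (simp add: splittings_def)

instantiation mfps :: (comm_ring_1, finite) comm_ring_1
begin

lift_definition zero_mfps :: "('a, 'b) mfps" is "\<lambda>_. 0" .
lift_definition one_mfps :: "('a, 'b) mfps" is "\<lambda>P. if P = 0 then 1 else 0" .
lift_definition plus_mfps :: "('a, 'b) mfps \<Rightarrow> ('a, 'b) mfps \<Rightarrow> ('a, 'b) mfps"
  is "\<lambda>f g P. f P + g P" .
lift_definition minus_mfps :: "('a, 'b) mfps \<Rightarrow> ('a, 'b) mfps \<Rightarrow> ('a, 'b) mfps"
  is "\<lambda>f g P. f P - g P" .
lift_definition uminus_mfps :: "('a, 'b) mfps \<Rightarrow> ('a, 'b) mfps"
  is "\<lambda>f P. - f P" .
lift_definition times_mfps :: "('a, 'b) mfps \<Rightarrow> ('a, 'b) mfps \<Rightarrow> ('a, 'b) mfps"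
  is "\<lambda>f g P. \<Sum>(A, B)\<in>splittings P. f A * g B" .

instance
proof
  fix f g h :: "('a, 'b) mfps"
  show "f + g + h = f + (g + h)" by transfer (simp add: algebra_simps)
  show "f + g = g + f" by transfer (simp add: algebra_simps)
  show "0 + f = f" by transfer simp
  show "- f + f = 0" by transfer simp
  show "f - g = f + - g" by transfer simp
  show "(0 :: ('a, 'b) mfps) \<noteq> 1" by transfer (metis zero_neq_one)
  show "(f + g) * h = f * h + g * h"
    by transfer (simp add: algebra_simps sum.distrib case_prod_unfold)
  show "1 * f = f"
  proof (transfer, rule ext)
    fix f :: "nat ^ 'b \<Rightarrow> 'a" and P :: "nat ^ 'b"
    have "(\<Sum>(A, B)\<in>splittings P. (if A = 0 then 1 else 0) * f B)
        = (\<Sum>(A, B)\<in>{(0 :: nat ^ 'b, P)}. (if A = 0 then 1 else 0) * f B)"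
      by (rule sum.mono_neutral_right) (auto split: if_splits)
    then show "(\<Sum>(A, B)\<in>splittings P. (if A = 0 then 1 else 0) * f B) = f P" by simp
  qed
  show "f * g = g * f"
  proof (transfer, rule ext)
    fix f g :: "nat ^ 'b \<Rightarrow> 'a" and P :: "nat ^ 'b"
    show "(\<Sum>(A, B)\<in>splittings P. f A * g B) = (\<Sum>(A, B)\<in>splittings P. g A * f B)"
      by (rule sum.reindex_bij_witness[where i = prod.swap and j = prod.swap])
         (auto simp: algebra_simps)
  qed
  show "f * g * h = f * (g * h)"
  proof (transfer, rule ext)
    fix f g h :: "nat ^ 'b \<Rightarrow> 'a" and P :: "nat ^ 'b"
    have "(\<Sum>(A, B)\<in>splittings P. (\<Sum>(C, D)\<in>splittings A. f C * g D) * h B)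
        = (\<Sum>(x, y)\<in>(SIGMA x:splittings P. splittings (fst x)). f (fst y) * g (snd y) * h (snd x))"
      by (subst sum.Sigma[symmetric]) (auto simp: case_prod_unfold sum_distrib_right)
    also have "\<dots> = (\<Sum>(x, y)\<in>(SIGMA x:splittings P. splittings (snd x)). f (fst x) * (g (fst y) * h (snd y)))"
      by (rule sum.reindex_bij_witness
            [where i = "\<lambda>(x, y). ((fst x + fst y, snd y), (fst x, fst y))"
               and j = "\<lambda>(x, y). ((fst y, snd y + snd x), (snd y, snd x))"])
         (auto simp: algebra_simps)
    also have "\<dots> = (\<Sum>(A, B)\<in>splittings P. f A * (\<Sum>(C, D)\<in>splittings B. g C * h D))"
      by (subst sum.Sigma[symmetric]) (auto simp: case_prod_unfold sum_distrib_left)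
    finally show "(\<Sum>(A, B)\<in>splittings P. (\<Sum>(C, D)\<in>splittings A. f C * g D) * h B)
        = (\<Sum>(A, B)\<in>splittings P. f A * (\<Sum>(C, D)\<in>splittings B. g C * h D))" .
  qed
qed

end

lemma exists_extremal_pair:
  fixes S T :: "(nat ^ 'n::finite) set"
  assumes "finite I" "S \<noteq> {}" "T \<noteq> {}"
  shows "\<exists>a\<in>S. \<exists>b\<in>T. \<forall>A\<in>S. \<forall>B\<in>T. A + B = a + b \<longrightarrow> (\<forall>i\<in>I. A $ i = a $ i \<and> B $ i = b $ i)"
  using assms
proof (induction I arbitrary: S T rule: finite_induct)
  case empty
  then show ?case by auto
next
  case (insert i I)
  obtain x y where "x \<in> S" "y \<in> T" using insert.prems by auto
  obtain A0 where A0: "A0 \<in> S" "\<And>A. A \<in> S \<Longrightarrow> A0 $ i \<le> A $ i"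
    using ex_has_least_nat[of "\<lambda>A. A \<in> S" x "\<lambda>A. A $ i"] \<open>x \<in> S\<close> by auto
  obtain B0 where B0: "B0 \<in> T" "\<And>B. B \<in> T \<Longrightarrow> B0 $ i \<le> B $ i"
    using ex_has_least_nat[of "\<lambda>B. B \<in> T" y "\<lambda>B. B $ i"] \<open>y \<in> T\<close> by auto
  define m l where "m = A0 $ i" and "l = B0 $ i"
  have m: "\<exists>A\<in>S. A $ i = m" "\<And>A. A \<in> S \<Longrightarrow> m \<le> A $ i"
    using A0 by (auto simp: m_def l_def)
  have l: "\<exists>B\<in>T. B $ i = l" "\<And>B. B \<in> T \<Longrightarrow> l \<le> B $ i"
    using B0 by (auto simp: m_def l_def)
  define S' T' where "S' = {A\<in>S. A $ i = m}" and "T' = {B\<in>T. B $ i = l}"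
  have "S' \<noteq> {}" "T' \<noteq> {}"
    using m(1) l(1) by (auto simp: S'_def T'_def)
  from insert.IH[OF this] obtain a b where aS: "a \<in> S'" and bT: "b \<in> T'"
    and IH: "\<forall>A\<in>S'. \<forall>B\<in>T'. A + B = a + b \<longrightarrow> (\<forall>i\<in>I. A $ i = a $ i \<and> B $ i = b $ i)"
    by blast
  have ab: "a \<in> S" "a $ i = m" "b \<in> T" "b $ i = l"
    using aS bT by (simp_all add: S'_def T'_def)
  show ?case
  proof (rule bexI[of _ a], rule bexI[of _ b], intro ballI impI)
    fix A B j
    assume AB: "A \<in> S" "B \<in> T" "A + B = a + b" and j: "j \<in> insert i I"
    have "A $ i + B $ i = m + l"
      using arg_cong[OF AB(3), of "\<lambda>P. P $ i"] ab by simp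
    with m(2)[OF AB(1)] l(2)[OF AB(2)] have *: "A $ i = m" "B $ i = l" by linarith+
    show "A $ j = a $ j \<and> B $ j = b $ j"
    proof (cases "j = i")
      case True
      with * ab show ?thesis by simp
    next
      case False
      with j have "j \<in> I" by simp
      moreover have "A \<in> S'" "B \<in> T'"
        using AB * by (simp_all add: S'_def T'_def)
      ultimately show ?thesis using IH[rule_format, of A B j] AB(3) by simp
    qed
  qed (rule ab)+
qed

instance mfps :: (idom, finite) idom
proof
  fix f g :: "('a, 'b) mfps"
  assume "f \<noteq> 0" "g \<noteq> 0"
  then have "{P. mfps_nth f P \<noteq> 0} \<noteq> {}" "{P. mfps_nth g P \<noteq> 0} \<noteq> {}"
    by (auto simp: mfps_eq_iff zero_mfps.rep_eq)
  from exists_extremal_pair[OF finite this]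
  obtain a b where ab: "mfps_nth f a \<noteq> 0" "mfps_nth g b \<noteq> 0"
    and "\<forall>A\<in>{P. mfps_nth f P \<noteq> 0}. \<forall>B\<in>{P. mfps_nth g P \<noteq> 0}.
      A + B = a + b \<longrightarrow> (\<forall>i\<in>UNIV. A $ i = a $ i \<and> B $ i = b $ i)"
    by blast
  then have *: "A = a \<and> B = b"
    if "mfps_nth f A \<noteq> 0" "mfps_nth g B \<noteq> 0" "A + B = a + b" for A B
    unfolding vec_eq_iff[of A a] vec_eq_iff[of B b] using that by blast
  have "mfps_nth (f * g) (a + b) = (\<Sum>(A, B)\<in>splittings (a + b). mfps_nth f A * mfps_nth g B)"
    by (simp add: times_mfps.rep_eq)
  also have "\<dots> = (\<Sum>(A, B)\<in>{(a, b)}. mfps_nth f A * mfps_nth g B)"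
  proof (rule sum.mono_neutral_right)
    show "\<forall>i\<in>splittings (a + b) - {(a, b)}. (case i of (A, B) \<Rightarrow> mfps_nth f A * mfps_nth g B) = 0"
    proof (rule ballI)
      fix x
      assume "x \<in> splittings (a + b) - {(a, b)}"
      with *[of "fst x" "snd x"]
      show "(case x of (A, B) \<Rightarrow> mfps_nth f A * mfps_nth g B) = 0"
        by (cases x) auto
    qed
  qed simp_all
  finally have "mfps_nth (f * g) (a + b) \<noteq> 0" using ab by simp
  then show "f * g \<noteq> 0" by (auto simp: zero_mfps.rep_eq)
qed

lift_definition mfps_const :: "'a::zero \<Rightarrow> ('a, 'n::finite) mfps"
  is "\<lambda>c P. if P = 0 then c else 0" .

lift_definition mfps_var :: "'n::finite \<Rightarrow> ('a::zero_neq_one, 'n) mfps"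
  is "\<lambda>i P. if P = axis i 1 then 1 else 0" .

lift_definition mfps_pderiv :: "'n::finite \<Rightarrow> ('a::comm_ring_1, 'n) mfps \<Rightarrow> ('a, 'n) mfps"
  is "\<lambda>i f P. of_nat (P $ i + 1) * f (P + axis i 1)" .

lemma mfps_pderiv_mult:
  fixes f g :: "('a::comm_ring_1, 'n::finite) mfps"
  shows "mfps_pderiv i (f * g) = mfps_pderiv i f * g + f * mfps_pderiv i g"
proof (transfer, rule ext)
  fix i :: 'n and f g :: "nat ^ 'n \<Rightarrow> 'a" and P :: "nat ^ 'n"
  let ?e = "axis i 1 :: nat ^ 'n"
  have shift: "A - axis i (Suc 0) + axis i (Suc 0) = A" "axis i (Suc 0) + (A - axis i (Suc 0)) = A"
    if "0 < A $ i" for A :: "nat ^ 'n"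
    using that by (simp_all add: vec_eq_iff axis_def)
  have cancel: "A - axis i (Suc 0) + B = P" "B + (A - axis i (Suc 0)) = P"
    if "A + B = P + axis i (Suc 0)" "0 < A $ i" for A B :: "nat ^ 'n"
  proof -
    have "A - axis i (Suc 0) + B + axis i (Suc 0) = P + axis i (Suc 0)"
      using shift(1)[OF that(2)] that(1) by (metis add.assoc add.commute)
    then show "A - axis i (Suc 0) + B = P" by (rule add_right_imp_eq)
    then show "B + (A - axis i (Suc 0)) = P" by (simp only: add.commute)
  qed
  have 1: "(\<Sum>(A, B)\<in>splittings (P + ?e). of_nat (A $ i) * f A * g B)
      = (\<Sum>(A, B)\<in>splittings P. of_nat (A $ i + 1) * f (A + ?e) * g B)"
  proof -
    have "(\<Sum>(A, B)\<in>splittings (P + ?e). of_nat (A $ i) * f A * g B)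
        = (\<Sum>(A, B)\<in>{(A, B)\<in>splittings (P + ?e). A $ i \<noteq> 0}. of_nat (A $ i) * f A * g B)"
      by (rule sum.mono_neutral_right) (auto intro: gr0I)
    also have "\<dots> = (\<Sum>(A, B)\<in>splittings P. of_nat (A $ i + 1) * f (A + ?e) * g B)"
      by (rule sum.reindex_bij_witness
            [where i = "\<lambda>(A, B). (A + ?e, B)" and j = "\<lambda>(A, B). (A - ?e, B)"])
         (auto simp: shift cancel add_ac)
    finally show ?thesis .
  qed
  have 2: "(\<Sum>(A, B)\<in>splittings (P + ?e). of_nat (B $ i) * f A * g B)
      = (\<Sum>(A, B)\<in>splittings P. f A * (of_nat (B $ i + 1) * g (B + ?e)))"
  proof -
    have "(\<Sum>(A, B)\<in>splittings (P + ?e). of_nat (B $ i) * f A * g B)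
        = (\<Sum>(A, B)\<in>{(A, B)\<in>splittings (P + ?e). B $ i \<noteq> 0}. of_nat (B $ i) * f A * g B)"
      by (rule sum.mono_neutral_right) (auto intro: gr0I)
    also have "\<dots> = (\<Sum>(A, B)\<in>splittings P. f A * (of_nat (B $ i + 1) * g (B + ?e)))"
      by (rule sum.reindex_bij_witness
            [where i = "\<lambda>(A, B). (A, B + ?e)" and j = "\<lambda>(A, B). (A, B - ?e)"])
         (use cancel in \<open>auto simp: shift mult_ac add.assoc add.commute\<close>)
    finally show ?thesis .
  qed
  have "of_nat (P $ i + 1) * (\<Sum>(A, B)\<in>splittings (P + ?e). f A * g B)
      = (\<Sum>(A, B)\<in>splittings (P + ?e). of_nat (A $ i) * f A * g B + of_nat (B $ i) * f A * g B)"
  proof (subst sum_distrib_left, rule sum.cong[OF refl], clarify)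
    fix A B assume "(A, B) \<in> splittings (P + ?e)"
    then have "A $ i + B $ i = P $ i + 1"
      by (metis axis_nth mem_splittings vector_add_component)
    then have "(of_nat (P $ i + 1) :: 'a) = of_nat (A $ i) + of_nat (B $ i)"
      by (metis of_nat_add)
    then show "of_nat (P $ i + 1) * (f A * g B)
        = of_nat (A $ i) * f A * g B + of_nat (B $ i) * f A * g B"
      by (simp add: algebra_simps)
  qed
  also have "\<dots> = (\<Sum>(A, B)\<in>splittings P. of_nat (A $ i + 1) * f (A + ?e) * g B)
      + (\<Sum>(A, B)\<in>splittings P. f A * (of_nat (B $ i + 1) * g (B + ?e)))"
    using 1 2 by (simp add: case_prod_unfold sum.distrib)
  finally show "of_nat (P $ i + 1) * (\<Sum>(A, B)\<in>splittings (P + ?e). f A * g B)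
      = (\<Sum>(A, B)\<in>splittings P. of_nat (A $ i + 1) * f (A + ?e) * g B)
      + (\<Sum>(A, B)\<in>splittings P. f A * (of_nat (B $ i + 1) * g (B + ?e)))" .
qed


subsection \<open>Formally meromorphic functions\<close>

type_synonym 'n meromorphic = "(complex, 'n) mfps fract"

definition mero_pderiv :: "'n::finite \<Rightarrow> 'n meromorphic \<Rightarrow> 'n meromorphic" where
  "mero_pderiv i \<psi> = (THE \<phi>. \<exists>a b. b \<noteq> 0 \<and> \<psi> = Fract a b \<and>
     \<phi> = Fract (mfps_pderiv i a * b - a * mfps_pderiv i b) (b * b))"

lemma mero_pderiv_Fract:
  assumes b: "b \<noteq> 0"
  shows "mero_pderiv i (Fract a b) = Fract (mfps_pderiv i a * b - a * mfps_pderiv i b) (b * b)"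
  unfolding mero_pderiv_def
proof (rule the_equality)
  let ?D = "mfps_pderiv i"
  fix \<phi>
  assume "\<exists>c d. d \<noteq> 0 \<and> Fract a b = Fract c d \<and> \<phi> = Fract (?D c * d - c * ?D d) (d * d)"
  then obtain c d where d: "d \<noteq> 0" and "Fract a b = Fract c d"
    and \<phi>: "\<phi> = Fract (?D c * d - c * ?D d) (d * d)" by blast
  with b have eq: "a * d = c * b" by (simp add: eq_fract)
  have D: "?D a * d + a * ?D d = ?D c * b + c * ?D b"
    using arg_cong[OF eq, of ?D] by (simp add: mfps_pderiv_mult)
  have "(?D a * b - a * ?D b) * (d * d) - (?D c * d - c * ?D d) * (b * b)
      = b * d * ((?D a * d + a * ?D d) - (?D c * b + c * ?D b))
        - (b * ?D d + d * ?D b) * (a * d - c * b)"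
    by (simp add: algebra_simps)
  also have "\<dots> = 0" by (simp only: D eq) simp
  finally have "(?D a * b - a * ?D b) * (d * d) = (?D c * d - c * ?D d) * (b * b)" by simp
  with b d \<phi> show "\<phi> = Fract (?D a * b - a * ?D b) (b * b)" by (metis eq_fract(1) mult_eq_0_iff)
qed (use b in blast)

definition mero_gradient :: "'n::finite meromorphic \<Rightarrow> 'n meromorphic ^ 'n" where
  "mero_gradient \<psi> = (\<chi> i. mero_pderiv i \<psi>)"

definition first_integral :: "(complex, 'n::finite) mfps ^ 'n \<Rightarrow> 'n meromorphic \<Rightarrow> bool" where
  "first_integral G \<psi> \<longleftrightarrow> (\<Sum>i\<in>UNIV. mero_gradient \<psi> $ i * to_fract (G $ i)) = 0"

text \<open>
  The Jacobian matrix of \<open>\<psi> 1, \<dots>, \<psi> d\<close> has the gradients as its rows; its (row) rank over the field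
  of formally meromorphic functions, in the form of \<open>row_rank_def_gen\<close>, is the dimension of their
  span.
\<close>

definition independent_functions :: "nat \<Rightarrow> (nat \<Rightarrow> 'n::finite meromorphic) \<Rightarrow> bool" where
  "independent_functions d \<psi> \<longleftrightarrow> vec.dim ((\<lambda>k. mero_gradient (\<psi> k)) ` {1..d}) = d"

definition mfps_free_of :: "'n::finite \<Rightarrow> (complex, 'n) mfps \<Rightarrow> bool" where
  "mfps_free_of j f \<longleftrightarrow> (\<forall>P. mfps_nth f P \<noteq> 0 \<longrightarrow> P $ j = 0)"

definition mero_free_of :: "'n::finite \<Rightarrow> 'n meromorphic \<Rightarrow> bool" where
  "mero_free_of j \<psi> \<longleftrightarrow>
     (\<exists>a b. b \<noteq> 0 \<and> \<psi> = Fract a b \<and> mfps_free_of j a \<and> mfps_free_of j b)"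

definition laurent_monomial :: "int ^ 'n \<Rightarrow> 'n::finite meromorphic" where
  "laurent_monomial Q = (\<Prod>i\<in>UNIV. to_fract (mfps_var i) powi (Q $ i))"


subsection \<open>Resonances\<close>

definition pairing :: "int ^ 'n \<Rightarrow> complex ^ 'n::finite \<Rightarrow> complex" where
  "pairing Q v = (\<Sum>i\<in>UNIV. of_int (Q $ i) * v $ i)"

definition exponents_at :: "'n::finite \<Rightarrow> (int ^ 'n) set" where
  "exponents_at i = {Q. Q $ i \<ge> -1 \<and> (\<forall>j. j \<noteq> i \<longrightarrow> Q $ j \<ge> 0)}"

definition exponents :: "(int ^ 'n::finite) set" where
  "exponents = (\<Union>i. exponents_at i)"

definition M_res :: "complex ^ 'n::finite \<Rightarrow> (int ^ 'n) set" where
  "M_res lam = {P \<in> exponents. pairing P lam = 0}"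

definition M_res_nonneg :: "complex ^ 'n::finite \<Rightarrow> (nat ^ 'n) set" where
  "M_res_nonneg lam = {P. pairing (\<chi> i. int (P $ i)) lam = 0}"

definition R_bar :: "complex ^ 'n::finite \<Rightarrow> (int ^ 'n) set" where
  "R_bar lam = {P. pairing P lam = 0}"

interpretation zvec: module "(*s) :: int \<Rightarrow> int ^ 'n::finite \<Rightarrow> int ^ 'n"
  by unfold_locales (vector algebra_simps)+

definition lattice_rank :: "(int ^ 'n::finite) set \<Rightarrow> nat" where
  "lattice_rank S = Max {card B | B. B \<subseteq> S \<and> zvec.independent B}"

definition rational_isoresonant ::
    "complex ^ 'n::finite \<Rightarrow> ('r \<Rightarrow> complex ^ 'n) \<Rightarrow> bool" where
  "rational_isoresonant lam \<Lambda> \<longleftrightarrow> (\<forall>P. pairing P lam = 0 \<longrightarrow> (\<forall>j. pairing P (\<Lambda> j) = 0))"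


subsection \<open>Formal vector fields in normal form\<close>

text \<open>
  \<open>vf_coeff G Q\<close> is the vector \<open>F_Q\<close> in \<open>G = (\<Sum>Q. (x \<odot> F_Q) x^Q)\<close>: its \<open>i\<close>-th entry is the
  coefficient of \<open>x_i x^Q\<close> in the \<open>i\<close>-th component of \<open>G\<close>.
\<close>

definition vf_coeff :: "(complex, 'n::finite) mfps ^ 'n \<Rightarrow> int ^ 'n \<Rightarrow> complex ^ 'n" where
  "vf_coeff G Q = (\<chi> i. if Q \<in> exponents_at i
     then mfps_nth (G $ i) (\<chi> k. nat ((Q + axis i 1) $ k)) else 0)"

lemma mfps_nth_eq_vf_coeff:
  fixes P :: "nat ^ 'n::finite"
  shows "(\<chi> k. int (P $ k)) - axis i 1 \<in> exponents_at i"
    and "mfps_nth (G $ i) P = vf_coeff G ((\<chi> k. int (P $ k)) - axis i 1) $ i"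
proof -
  show *: "(\<chi> k. int (P $ k)) - axis i 1 \<in> exponents_at i"
    by (auto simp: exponents_at_def axis_def)
  have "(\<chi> k. nat (((\<chi> k. int (P $ k)) - axis i 1 + axis i 1) $ k)) = P"
    by (simp add: vec_eq_iff)
  with * show "mfps_nth (G $ i) P = vf_coeff G ((\<chi> k. int (P $ k)) - axis i 1) $ i"
    by (simp add: vf_coeff_def)
qed

definition linear_part :: "(complex, 'n::finite) mfps ^ 'n \<Rightarrow> complex ^ 'n ^ 'n" where
  "linear_part G = (\<chi> i j. mfps_nth (G $ i) (axis j 1))"

text \<open>
  A finite linear order on the indices plays the role of the order of \<open>1, \<dots>, n\<close>, so the index
  \<open>i - 1\<close> is the immediate predecessor of \<open>i\<close>.
\<close>

definition is_pred :: "'a::linorder \<Rightarrow> 'a \<Rightarrow> bool" where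
  "is_pred j i \<longleftrightarrow> j < i \<and> {j<..<i} = {}"

definition lower_jordan ::
    "(complex, 'n::{finite,linorder}) vec \<Rightarrow> (complex, 'n) vec \<Rightarrow> ((complex, 'n) vec, 'n) vec" where
  "lower_jordan lam \<sigma> = (\<chi> i j. if j = i then lam $ i else if is_pred j i then \<sigma> $ i else 0)"

definition poincare_dulac_normal_form ::
    "(complex, 'n::{finite,linorder}) vec \<Rightarrow> ((complex, 'n) mfps, 'n) vec \<Rightarrow> bool" where
  "poincare_dulac_normal_form lam G \<longleftrightarrow>
     (\<forall>i. mfps_nth (G $ i) 0 = 0) \<and>
     (\<exists>\<sigma>. linear_part G = lower_jordan lam \<sigma> \<and>
          (\<forall>i j. is_pred j i \<and> lam $ i \<noteq> lam $ j \<longrightarrow> \<sigma> $ i = 0)) \<and>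
     (\<forall>Q\<in>exponents. vf_coeff G Q \<noteq> 0 \<longrightarrow> Q \<in> M_res lam)"

definition maximal_meromorphic_integrable ::
    "complex ^ 'n::finite \<Rightarrow> (complex, 'n) mfps ^ 'n \<Rightarrow> bool" where
  "maximal_meromorphic_integrable lam G \<longleftrightarrow>
     (\<exists>\<psi>. (\<forall>k\<in>{1..lattice_rank (R_bar lam)}. first_integral G (\<psi> k)) \<and>
          independent_functions (lattice_rank (R_bar lam)) \<psi>)"

text \<open>The linear diagonal vector field \<open>v \<odot> x\<close>.\<close>

definition diag_vf :: "complex ^ 'n::finite \<Rightarrow> (complex, 'n) mfps ^ 'n" where
  "diag_vf v = (\<chi> i. mfps_const (v $ i) * mfps_var i)"

definition to_mero_vec :: "(complex, 'n::finite) mfps ^ 'n \<Rightarrow> 'n meromorphic ^ 'n" where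
  "to_mero_vec G = (\<chi> i. to_fract (G $ i))"

text \<open>The matrix with columns \<open>\<Lambda> j \<odot> x\<close>, over the field of formally meromorphic functions.\<close>

definition column_matrix ::
    "('r \<Rightarrow> complex ^ 'n::finite) \<Rightarrow> 'n meromorphic ^ 'r::finite ^ 'n" where
  "column_matrix \<Lambda> = (\<chi> i j. to_mero_vec (diag_vf (\<Lambda> j)) $ i)"

text \<open>
  The number of rows is part of a matrix type, so the rank of the matrix with row \<open>j\<close> omitted is
  written as the dimension of the span of the remaining rows (cf. \<open>row_rank_def_gen\<close>).
\<close>

definition exceptional_index :: "('r::finite \<Rightarrow> complex ^ 'n::finite) \<Rightarrow> 'n \<Rightarrow> bool" where
  "exceptional_index \<Lambda> j \<longleftrightarrow> vec.dim {row i (column_matrix \<Lambda>) | i. i \<noteq> j} < CARD('r)"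

end

theory Submission
  imports Defs
begin

text \<open>
  Write \<open>L\<close> for the Lie derivative along \<open>G\<close> and \<open>D\<^sub>\<mu>\<close> for the one along \<open>\<mu> \<odot> x\<close>, which multiplies
  \<open>x\<^sup>P\<close> by \<open>\<langle>P, \<mu>\<rangle>\<close>. Everything rests on one fact (\<open>first_integral_torus\<close>): a meromorphic first
  integral of \<open>G\<close> is a first integral of \<open>\<mu> \<odot> x\<close> for every \<open>\<mu>\<close> that is annihilated by all resonances of
  \<open>lam\<close>, that is, of the whole torus generated by the semisimple part of \<open>G\<close>.

  To prove it, give the variables positive integer weights for which every term of \<open>G\<close> other than
  \<open>lam \<odot> x\<close> raises the weighted order; then \<open>L\<close> acts on leading forms as \<open>D\<^bsub>lam\<^esub>\<close>. Normal form means
  that \<open>D\<^sub>\<mu>\<close> commutes with \<open>L\<close>, so with a first integral \<open>\<psi> = f / g\<close> also \<open>\<phi> = D\<^sub>\<mu> \<psi>\<close> is one. If \<open>\<phi>\<close>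
  were nonzero, its leading form would have \<open>lam\<close>-weight zero, hence \<open>\<mu>\<close>-weight zero. But a form in the
  image of \<open>D\<^sub>\<mu>\<close> has no component of \<open>\<mu>\<close>-weight zero. To make sense of the expansion of \<open>\<psi>\<close> into
  forms, the weights are chosen so generic that the leading form of \<open>g\<close> is a single monomial; then
  \<open>\<psi>\<close> can be approximated to any order by a Laurent series with monomial denominator
  (\<open>exists_weights_monomial_leading_form\<close>, \<open>approximate_quotient\<close>).

  The gradients of \<open>n - r\<close> independent first integrals are therefore orthogonal to the \<open>r\<close> independent
  fields \<open>\<Lambda> j \<odot> x\<close> as well as to \<open>G\<close>, and a dimension count puts \<open>G\<close> into the meromorphic span of the
  \<open>\<Lambda> j \<odot> x\<close>. For part (b) the coefficients must be power series. Applying a constant left inverse of the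
  matrix with columns \<open>\<Lambda> j\<close> gives, for each exponent \<open>P\<close>, that the coefficient vector \<open>G\<^sub>P\<close> lies in the
  complex span of the \<open>\<Lambda> j\<close>. If \<open>P\<close> has an entry \<open>-1\<close> in position \<open>i\<close>, then \<open>G\<^sub>P\<close> is a multiple of the
  \<open>i\<close>-th unit vector; a nonzero multiple would make that unit vector orthogonal to the resonance \<open>P\<close>,
  contradicting \<open>P\<^sub>i = -1\<close>. So no negative exponents occur, and the coefficients can be read off.

  For part (a), a resonance \<open>P\<close> with \<open>P\<^sub>j \<noteq> 0\<close> expresses row \<open>j\<close> of the matrix by the others, so the rank
  would not drop when it is omitted. Hence for exceptional \<open>j\<close> all resonances have \<open>P\<^sub>j = 0\<close>, the key fact
  applies to \<open>\<mu> = e\<^sub>j\<close>, and \<open>x\<^sub>j \<partial>\<^sub>j \<psi> = 0\<close>; comparing lowest powers of \<open>x\<^sub>j\<close> shows that \<open>\<psi>\<close> is a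
  quotient of series without \<open>x\<^sub>j\<close>.
\<close>


section \<open>Monomials and coefficients\<close>

lift_definition monomial :: "nat ^ 'n::finite \<Rightarrow> ('a::zero_neq_one, 'n) mfps"
  is "\<lambda>A P. if P = A then 1 else 0" .

lemma mfps_nth_mult:
  "mfps_nth (f * g) P = (\<Sum>(A, B)\<in>splittings P. mfps_nth f A * mfps_nth g B)"
  by (simp add: times_mfps.rep_eq)

lemma mfps_nth_sum: "mfps_nth (\<Sum>i\<in>I. f i) P = (\<Sum>i\<in>I. mfps_nth (f i) P)"
  by (induction I rule: infinite_finite_induct) (simp_all add: zero_mfps.rep_eq plus_mfps.rep_eq)

lemmas mfps_nth_simps = zero_mfps.rep_eq plus_mfps.rep_eq minus_mfps.rep_eq mfps_nth_sum

lemma mfps_nth_mult_nonzeroE: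
  assumes "mfps_nth (f * g) P \<noteq> 0"
  obtains A B where "A + B = P" "mfps_nth f A \<noteq> 0" "mfps_nth g B \<noteq> 0"
proof -
  obtain x where "x \<in> splittings P" "(case x of (A, B) \<Rightarrow> mfps_nth f A * mfps_nth g B) \<noteq> 0"
    using assms unfolding mfps_nth_mult by (meson sum.neutral)
  then show ?thesis using that by (cases x) (auto, metis mult_zero_left mult_zero_right)
qed

lemma mfps_nth_const_mult [simp]:
  fixes f :: "('a::comm_ring_1, 'b::finite) mfps"
  shows "mfps_nth (mfps_const c * f) P = c * mfps_nth f P"
proof -
  have "mfps_nth (mfps_const c * f) P = (\<Sum>(A, B)\<in>{(0 :: nat ^ 'b, P)}. mfps_nth (mfps_const c) A * mfps_nth f B)"
    unfolding mfps_nth_mult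
    by (rule sum.mono_neutral_right) (auto simp: mfps_const.rep_eq split: if_splits)
  then show ?thesis by (simp add: mfps_const.rep_eq)
qed

lemma mfps_nth_monomial_mult [simp]:
  "mfps_nth (monomial A * f) (A + P) = mfps_nth f P"
proof -
  have "mfps_nth (monomial A * f) (A + P)
      = (\<Sum>(B, C)\<in>{(A, P)}. mfps_nth (monomial A) B * mfps_nth f C)"
    unfolding mfps_nth_mult
    by (rule sum.mono_neutral_right) (auto simp: monomial.rep_eq split: if_splits)
  then show ?thesis by (simp add: monomial.rep_eq)
qed

lemma mfps_nth_monomial_mult_eq_0:
  fixes f :: "('a::comm_ring_1, 'b::finite) mfps"
  assumes "\<not> (\<forall>i. A $ i \<le> P $ i)"
  shows "mfps_nth (monomial A * f) P = 0"
proof (rule ccontr)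
  assume "mfps_nth (monomial A * f) P \<noteq> 0"
  then obtain B C where "B + C = P" "mfps_nth (monomial A :: ('a, 'b) mfps) B \<noteq> 0"
    by (rule mfps_nth_mult_nonzeroE)
  then have "A + C = P" by (simp add: monomial.rep_eq split: if_splits)
  then show False using assms by (metis le_add1 vector_add_component)
qed

lemma vec_nat_le_ex:
  fixes A P :: "nat ^ 'n"
  assumes "\<forall>i. A $ i \<le> P $ i"
  obtains C where "P = A + C"
  using that[of "P - A"] assms by (simp add: vec_eq_iff)

lemma monomial_mult: "monomial A * monomial B = (monomial (A + B) :: ('a::comm_ring_1, 'n::finite) mfps)"
proof (rule mfps_eqI)
  fix P
  show "mfps_nth (monomial A * monomial B) P = mfps_nth (monomial (A + B) :: ('a, 'n) mfps) P"
  proof (cases "\<forall>i. A $ i \<le> P $ i")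
    case True
    then obtain C where "P = A + C" by (rule vec_nat_le_ex)
    then show ?thesis by (simp add: monomial.rep_eq)
  next
    case False
    then have "P \<noteq> A + B" by auto
    with False show ?thesis by (simp add: mfps_nth_monomial_mult_eq_0 monomial.rep_eq)
  qed
qed

lemma monomial_neq_0 [simp]: "monomial A \<noteq> 0"
  by (auto simp: mfps_eq_iff monomial.rep_eq mfps_nth_simps)

lemma mfps_var_eq_monomial: "mfps_var i = monomial (axis i 1)"
  by (rule mfps_eqI) (simp add: monomial.rep_eq mfps_var.rep_eq)

lemma mfps_const_mult_const: "mfps_const (a * b) = mfps_const a * (mfps_const b :: ('a::comm_ring_1, 'n::finite) mfps)"
  by (rule mfps_eqI) (simp, simp add: mfps_const.rep_eq)

lemma mfps_const_1: "mfps_const 1 = 1"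
  by (rule mfps_eqI) (simp add: mfps_const.rep_eq one_mfps.rep_eq)

lemma mfps_const_0: "mfps_const 0 = 0"
  by (rule mfps_eqI) (simp add: mfps_const.rep_eq zero_mfps.rep_eq)

lemma mfps_const_add: "mfps_const (a + b) = mfps_const a + (mfps_const b :: ('a::comm_ring_1, 'n::finite) mfps)"
  by (rule mfps_eqI) (simp add: mfps_const.rep_eq plus_mfps.rep_eq)

lemma mfps_const_eq_0_iff [simp]: "mfps_const a = 0 \<longleftrightarrow> a = 0"
  by (metis mfps_const.rep_eq mfps_const_0 zero_mfps.rep_eq)

section \<open>The derivation along a vector field\<close>

definition lie :: "('a::comm_ring_1, 'n::finite) mfps ^ 'n \<Rightarrow> ('a, 'n) mfps \<Rightarrow> ('a, 'n) mfps" where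
  "lie G f = (\<Sum>i\<in>UNIV. G $ i * mfps_pderiv i f)"

lemma mfps_pderiv_add: "mfps_pderiv i (f + g) = mfps_pderiv i f + mfps_pderiv i g"
  by (rule mfps_eqI) (simp add: mfps_pderiv.rep_eq mfps_nth_simps algebra_simps)

lemma mfps_pderiv_diff: "mfps_pderiv i (f - g) = mfps_pderiv i f - mfps_pderiv i g"
  by (rule mfps_eqI) (simp add: mfps_pderiv.rep_eq mfps_nth_simps algebra_simps)

lemma lie_add: "lie G (f + g) = lie G f + lie G g"
  by (simp add: lie_def mfps_pderiv_add sum.distrib algebra_simps)

lemma lie_diff: "lie G (f - g) = lie G f - lie G g"
  by (simp add: lie_def mfps_pderiv_diff sum_subtractf algebra_simps)

lemma lie_mult: "lie G (f * g) = lie G f * g + f * lie G g"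
  by (simp add: lie_def mfps_pderiv_mult sum.distrib sum_distrib_left sum_distrib_right algebra_simps)

lemma lie_sum: "lie G (\<Sum>k\<in>K. f k) = (\<Sum>k\<in>K. lie G (f k))"
proof (induction K rule: infinite_finite_induct)
  case empty
  have "lie G 0 = 0" using lie_diff[of G 0 0] by simp
  then show ?case by simp
next
  case (infinite A)
  have "lie G 0 = 0" using lie_diff[of G 0 0] by simp
  then show ?case using infinite by simp
qed (simp add: lie_add)

definition weight :: "complex ^ 'n::finite \<Rightarrow> nat ^ 'n \<Rightarrow> complex" where
  "weight \<mu> P = (\<Sum>i\<in>UNIV. of_nat (P $ i) * \<mu> $ i)"

lemma weight_add: "weight \<mu> (A + B) = weight \<mu> A + weight \<mu> B"
  by (simp add: weight_def algebra_simps sum.distrib)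

lemma weight_axis: "weight \<mu> (axis i 1) = \<mu> $ i"
proof -
  have "weight \<mu> (axis i 1) = (\<Sum>k\<in>UNIV. if k = i then \<mu> $ i else 0)"
    unfolding weight_def by (rule sum.cong) (auto simp: axis_def)
  then show ?thesis by simp
qed

lemma mfps_nth_var_pderiv:
  fixes f :: "('a::comm_ring_1, 'n::finite) mfps"
  shows "mfps_nth (mfps_var i * mfps_pderiv i f) P = of_nat (P $ i) * mfps_nth f P"
proof (cases "\<forall>k. (axis i 1 :: nat ^ 'n) $ k \<le> P $ k")
  case True
  then obtain C where C: "P = axis i 1 + C" by (rule vec_nat_le_ex)
  have "of_nat (C $ i + 1) = (of_nat (P $ i) :: 'a)" unfolding C by (simp add: axis_def)
  moreover have "mfps_nth (monomial (axis i 1) * mfps_pderiv i f) (axis i 1 + C)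
      = of_nat (C $ i + 1) * mfps_nth f (C + axis i 1)"
    by (simp only: mfps_nth_monomial_mult mfps_pderiv.rep_eq)
  ultimately show ?thesis unfolding mfps_var_eq_monomial by (metis C add.commute)
next
  case False
  then have "P $ i = 0" by (auto simp: axis_def split: if_splits)
  with False show ?thesis by (simp add: mfps_var_eq_monomial mfps_nth_monomial_mult_eq_0)
qed

lemma mfps_nth_lie_diag [simp]:
  "mfps_nth (lie (diag_vf \<mu>) f) P = weight \<mu> P * mfps_nth f P"
proof -
  have "mfps_nth (diag_vf \<mu> $ i * mfps_pderiv i f) P = of_nat (P $ i) * \<mu> $ i * mfps_nth f P" for i
    by (simp only: diag_vf_def vec_lambda_beta mult.assoc mfps_nth_const_mult mfps_nth_var_pderiv)
       (simp only: mult_ac)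
  then show ?thesis by (simp add: lie_def mfps_nth_sum weight_def sum_distrib_right)
qed

lemma lie_diag_monomial: "lie (diag_vf \<mu>) (monomial A) = mfps_const (weight \<mu> A) * monomial A"
  by (rule mfps_eqI) (simp add: monomial.rep_eq)

lemma lie_diag_const_mult: "lie (diag_vf \<mu>) (mfps_const c * f) = mfps_const c * lie (diag_vf \<mu>) f"
  by (rule mfps_eqI) simp

section \<open>Weighted orders and leading forms\<close>

definition wdeg :: "('n \<Rightarrow> nat) \<Rightarrow> nat ^ 'n::finite \<Rightarrow> nat" where
  "wdeg w P = (\<Sum>i\<in>UNIV. w i * P $ i)"

lemma wdeg_add: "wdeg w (A + B) = wdeg w A + wdeg w B"
  by (simp add: wdeg_def algebra_simps sum.distrib)

lemma wdeg_axis: "wdeg w (axis i 1) = w i"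
proof -
  have "wdeg w (axis i 1) = (\<Sum>k\<in>UNIV. if k = i then w i else 0)"
    unfolding wdeg_def by (rule sum.cong) (auto simp: axis_def)
  then show ?thesis by simp
qed

text \<open>
  Every series satisfies \<open>order_ge w 0\<close>, and the zero series satisfies \<open>order_ge w k\<close> for all \<open>k\<close>; stating
  lower bounds avoids a value for the order of zero.
\<close>

definition order_ge :: "('n \<Rightarrow> nat) \<Rightarrow> nat \<Rightarrow> ('a::zero, 'n::finite) mfps \<Rightarrow> bool" where
  "order_ge w k f \<longleftrightarrow> (\<forall>P. mfps_nth f P \<noteq> 0 \<longrightarrow> k \<le> wdeg w P)"

lift_definition form :: "('n::finite \<Rightarrow> nat) \<Rightarrow> nat \<Rightarrow> ('a::zero, 'n) mfps \<Rightarrow> ('a, 'n) mfps"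
  is "\<lambda>w k f P. if wdeg w P = k then f P else 0" .

lemma order_geD: "order_ge w k f \<Longrightarrow> wdeg w P < k \<Longrightarrow> mfps_nth f P = 0"
  by (force simp: order_ge_def)

lemma order_ge_0 [simp]: "order_ge w 0 f"
  by (simp add: order_ge_def)

lemma order_ge_mono: "order_ge w k f \<Longrightarrow> l \<le> k \<Longrightarrow> order_ge w l f"
  by (force simp: order_ge_def)

lemma order_ge_diff:
  fixes f g :: "('a::comm_ring_1, 'n::finite) mfps"
  shows "order_ge w k f \<Longrightarrow> order_ge w k g \<Longrightarrow> order_ge w k (f - g)"
  by (auto simp: order_ge_def mfps_nth_simps) (metis diff_0_right)

lemma order_ge_sum:
  fixes f :: "'b \<Rightarrow> ('a::comm_ring_1, 'n::finite) mfps"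
  shows "(\<And>i. i \<in> I \<Longrightarrow> order_ge w k (f i)) \<Longrightarrow> order_ge w k (\<Sum>i\<in>I. f i)"
  unfolding order_ge_def mfps_nth_simps by (meson sum.neutral)

lemma order_ge_mult:
  fixes f g :: "('a::comm_ring_1, 'n::finite) mfps"
  assumes "order_ge w k f" "order_ge w l g"
  shows "order_ge w (k + l) (f * g)"
  unfolding order_ge_def
proof (intro allI impI)
  fix P assume "mfps_nth (f * g) P \<noteq> 0"
  then obtain A B where "A + B = P" "mfps_nth f A \<noteq> 0" "mfps_nth g B \<noteq> 0"
    by (rule mfps_nth_mult_nonzeroE)
  then show "k + l \<le> wdeg w P" using assms by (auto simp: order_ge_def wdeg_add add_mono)
qed

lemma order_ge_lie_diag: "order_ge w k f \<Longrightarrow> order_ge w k (lie (diag_vf \<mu>) f)"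
  by (auto simp: order_ge_def)

lemma order_ge_Suc_iff: "order_ge w (Suc k) f \<longleftrightarrow> order_ge w k f \<and> form w k f = 0"
  by (auto simp: order_ge_def mfps_eq_iff form.rep_eq zero_mfps.rep_eq Suc_le_eq
      order.strict_iff_order)

lemma order_ge_form [simp]: "order_ge w k (form w k f)"
  by (simp add: order_ge_def form.rep_eq)

lemma form_diff: "form w k (f - g) = form w k f - form w k (g :: ('a::comm_ring_1, 'n::finite) mfps)"
  by (rule mfps_eqI) (simp add: form.rep_eq mfps_nth_simps)

lemma form_add: "form w k (f + g) = form w k f + form w k (g :: ('a::comm_ring_1, 'n::finite) mfps)"
  by (rule mfps_eqI) (simp add: form.rep_eq mfps_nth_simps)

lemma form_form [simp]: "form w k (form w k f) = form w k f"
  by (rule mfps_eqI) (simp add: form.rep_eq)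

lemma form_lie_diag: "form w k (lie (diag_vf \<mu>) f) = lie (diag_vf \<mu>) (form w k f)"
  by (rule mfps_eqI) (simp add: form.rep_eq)

lemma form_eq_0: "order_ge w k f \<Longrightarrow> l < k \<Longrightarrow> form w l f = 0"
  by (rule mfps_eqI) (simp add: form.rep_eq zero_mfps.rep_eq order_geD)

text \<open>
  The lowest forms multiply. The bounds \<open>k\<close> and \<open>l\<close> need not be attained, so one of the two forms, and
  then the product, may vanish.
\<close>

lemma form_mult:
  fixes f g :: "('a::comm_ring_1, 'n::finite) mfps"
  assumes "order_ge w k f" "order_ge w l g"
  shows "form w (k + l) (f * g) = form w k f * form w l g"
proof (rule mfps_eqI)
  fix P
  show "mfps_nth (form w (k + l) (f * g)) P = mfps_nth (form w k f * form w l g) P"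
  proof (cases "wdeg w P = k + l")
    case True
    have "mfps_nth f A * mfps_nth g B = mfps_nth (form w k f) A * mfps_nth (form w l g) B"
      if "A + B = P" for A B
    proof -
      have "wdeg w A + wdeg w B = k + l" using True that by (metis wdeg_add)
      then consider "wdeg w A < k" | "wdeg w B < l" | "wdeg w A = k" "wdeg w B = l" by linarith
      then show ?thesis
        by cases (simp_all add: form.rep_eq order_geD[OF assms(1)] order_geD[OF assms(2)])
    qed
    then have "mfps_nth (f * g) P = mfps_nth (form w k f * form w l g) P"
      unfolding mfps_nth_mult by (intro sum.cong) auto
    then show ?thesis using True by (simp add: form.rep_eq)
  next
    case False
    have "mfps_nth (form w k f * form w l g) P = 0"
    proof (rule ccontr)
      assume "mfps_nth (form w k f * form w l g) P \<noteq> 0"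
      then obtain A B where "A + B = P" "mfps_nth (form w k f) A \<noteq> 0" "mfps_nth (form w l g) B \<noteq> 0"
        by (rule mfps_nth_mult_nonzeroE)
      then show False using False by (auto simp: form.rep_eq wdeg_add split: if_splits)
    qed
    then show ?thesis using False by (simp add: form.rep_eq)
  qed
qed

lemma form_monomial_mult:
  fixes f :: "('a::comm_ring_1, 'n::finite) mfps"
  assumes "order_ge w k f"
  shows "form w (wdeg w A + k) (monomial A * f) = monomial A * form w k f"
proof -
  have "order_ge w (wdeg w A) (monomial A :: ('a, 'n) mfps)"
    by (simp add: order_ge_def monomial.rep_eq)
  moreover have "form w (wdeg w A) (monomial A :: ('a, 'n) mfps) = monomial A"
    by (rule mfps_eqI) (simp add: form.rep_eq monomial.rep_eq)
  ultimately show ?thesis using assms by (simp add: form_mult)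
qed

lemma exists_leading_form:
  assumes "f \<noteq> 0"
  obtains k where "order_ge w k f" "form w k f \<noteq> 0"
proof -
  let ?S = "\<lambda>k. \<exists>P. mfps_nth f P \<noteq> 0 \<and> wdeg w P = k"
  obtain P0 where "mfps_nth f P0 \<noteq> 0" using assms by (auto simp: mfps_eq_iff zero_mfps.rep_eq)
  then have "\<exists>k. ?S k" by blast
  then have 1: "?S (LEAST k. ?S k)" by (rule LeastI_ex)
  have "order_ge w (LEAST k. ?S k) f" unfolding order_ge_def by (blast intro: Least_le)
  moreover have "form w (LEAST k. ?S k) f \<noteq> 0"
    using 1 by (auto simp: mfps_eq_iff zero_mfps.rep_eq form.rep_eq)
  ultimately show ?thesis by (rule that)
qed



section \<open>Generic weights\<close>

text \<open>
  The first condition makes the terms \<open>\<sigma>\<^sub>i x\<^bsub>i-1\<^esub> \<partial>\<^sub>i\<close> of the nilpotent part raise the weighted degree, the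
  second does the same for all terms of degree at least two.
\<close>

definition admissible_weights :: "('n::linorder \<Rightarrow> nat) \<Rightarrow> bool" where
  "admissible_weights w \<longleftrightarrow> (\<forall>i j. j < i \<longrightarrow> w i < w j) \<and> (\<forall>i j k. w i < w j + w k)"

lemma card_upset_less:
  fixes i j :: "'n::{finite,linorder}"
  assumes "j < i"
  shows "card {k. i \<le> k} < card {k. j \<le> k}"
proof (rule psubset_card_mono)
  have "j \<in> {k. j \<le> k} - {k. i \<le> k}" using assms by simp
  then show "{k. i \<le> k} \<subset> {k. j \<le> k}" using assms by auto
qed simp

lemma finite_wdeg_1: "finite {P :: nat ^ 'n::finite. wdeg (\<lambda>_. 1) P = m}"
proof (rule finite_subset)
  show "{P :: nat ^ 'n. wdeg (\<lambda>_. 1) P = m} \<subseteq> {P. \<forall>i. P $ i \<le> (\<chi> i. m) $ i}"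
    using member_le_sum[of _ UNIV "\<lambda>i. P $ i" for P :: "nat ^ 'n"] by (auto simp: wdeg_def)
qed (rule finite_vec_le)

text \<open>
  Two exponents have the same degree for the weights \<open>t ^ c i\<close> exactly if \<open>t\<close> is a root of a nonzero
  polynomial, because the \<open>c i\<close> are distinct. Finitely many exponents exclude finitely many \<open>t\<close>. The
  choice of \<open>c\<close> makes the weights decrease along the order of the indices.
\<close>

lemma exists_separating_base:
  fixes S :: "(nat ^ 'n::{finite,linorder}) set"
  assumes "finite S"
  obtains t :: nat where "2 \<le> t"
    "\<And>P P'. P \<in> S \<Longrightarrow> P' \<in> S \<Longrightarrow> wdeg (\<lambda>i. t ^ card {k. i \<le> k}) P = wdeg (\<lambda>i. t ^ card {k. i \<le> k}) P'
      \<Longrightarrow> P = P'"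
proof -
  define c where "c i = card {k. i \<le> k}" for i :: 'n
  have c_inj: "c i = c j \<longleftrightarrow> i = j" for i j
    using card_upset_less[of i j] card_upset_less[of j i] linorder_less_linear[of i j]
    by (auto simp: c_def)
  define p :: "(nat, 'n) vec \<Rightarrow> (nat, 'n) vec \<Rightarrow> int poly"
    where "p P P' = (\<Sum>i\<in>UNIV. monom (int (P $ i) - int (P' $ i)) (c i))" for P P'
  have coeff_p: "coeff (p P P') (c i) = int (P $ i) - int (P' $ i)" for P P' i
    by (simp add: p_def coeff_sum coeff_monom c_inj)
  have p0: "p P P' \<noteq> 0" if "P \<noteq> P'" for P P'
  proof
    assume "p P P' = 0"
    then have "int (P $ i) - int (P' $ i) = 0" for i using coeff_p[of P P' i] by simp
    then show False using that by (simp add: vec_eq_iff)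
  qed
  have "finite (\<Union>P\<in>S. \<Union>P'\<in>S - {P}. {x. poly (p P P') x = 0})" (is "finite ?R")
  proof (intro finite_UN_I finite_Diff assms)
    fix P P' assume "P' \<in> S - {P}"
    then show "finite {x. poly (p P P') x = 0}" by (intro poly_roots_finite p0) auto
  qed
  have "finite (int -` ?R)" using \<open>finite ?R\<close> by (intro finite_vimageI) auto
  then have "finite (int -` ?R \<union> {..1})" by simp
  then obtain t :: nat where t: "t \<notin> int -` ?R \<union> {..1}" using ex_new_if_finite[OF infinite_UNIV_nat] by blast
  show ?thesis
  proof (rule that[of t])
    show "2 \<le> t" using t by auto
    fix P P' assume P: "P \<in> S" "P' \<in> S" "wdeg (\<lambda>i. t ^ card {k. i \<le> k}) P = wdeg (\<lambda>i. t ^ card {k. i \<le> k}) P'"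
    have "int (wdeg (\<lambda>i. t ^ c i) P) - int (wdeg (\<lambda>i. t ^ c i) P') = poly (p P P') (int t)"
      by (simp add: p_def poly_sum poly_monom wdeg_def left_diff_distrib right_diff_distrib sum_subtractf mult.commute)
    then have "poly (p P P') (int t) = 0" using P(3) by (simp add: c_def)
    then have "t \<in> int -` ?R" if "P \<noteq> P'" using P(1,2) that by (intro vimageI2 UN_I) auto
    then show "P = P'" using t by blast
  qed
qed

text \<open>
  The weights are a large multiple \<open>M\<close> of the ordinary degree, perturbed by separating weights: \<open>M\<close>
  confines the minimum to the finitely many exponents of lowest ordinary degree, and the perturbation
  singles out one of them.
\<close>

lemma exists_weights_monomial_leading_form:
  fixes g :: "(complex, 'n::{finite,linorder}) mfps"
  assumes "g \<noteq> 0"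
  obtains w c B where "admissible_weights w" "c \<noteq> 0" "order_ge w (wdeg w B) g"
    "form w (wdeg w B) g = mfps_const c * monomial B"
proof -
  obtain m where m: "order_ge (\<lambda>_. 1) m g" "form (\<lambda>_. 1) m g \<noteq> 0"
    using exists_leading_form[OF assms] .
  define S where "S = {P. mfps_nth g P \<noteq> 0 \<and> wdeg (\<lambda>_. 1) P = m}"
  have "S \<noteq> {}" using m(2) by (auto simp: S_def mfps_eq_iff form.rep_eq zero_mfps.rep_eq split: if_splits)
  have "finite S" by (rule finite_subset[OF _ finite_wdeg_1[of m]]) (auto simp: S_def)
  then obtain t :: nat where t: "2 \<le> t" "\<And>P P'. P \<in> S \<Longrightarrow> P' \<in> S \<Longrightarrow>
      wdeg (\<lambda>i. t ^ card {k. i \<le> k}) P = wdeg (\<lambda>i. t ^ card {k. i \<le> k}) P' \<Longrightarrow> P = P'"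
    using exists_separating_base by blast
  define u :: "'n \<Rightarrow> nat" where "u i = t ^ card {k. i \<le> k}" for i
  have u_less: "u i < u j" if "j < i" for i j
    unfolding u_def using t(1) card_upset_less[OF that] by (intro power_strict_increasing) auto
  have t2: "P = P'" if "P \<in> S" "P' \<in> S" "wdeg u P = wdeg u P'" for P P'
    using t(2)[OF that(1,2)] that(3) by (simp add: u_def[abs_def])
  obtain B where B: "B \<in> S" "\<And>P. P \<in> S \<Longrightarrow> wdeg u B \<le> wdeg u P"
    using ex_has_least_nat[of "\<lambda>P. P \<in> S" _ "wdeg u"] \<open>S \<noteq> {}\<close> by (metis ex_in_conv)
  (* wdeg u B < M keeps higher ordinary degrees above B; u i < M gives w i < w j + w k. *)
  define M where "M = wdeg u B + (\<Sum>i\<in>UNIV. u i) + 1"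
  define w where "w i = M + u i" for i
  have u_le: "u i < M" for i
    using member_le_sum[of i UNIV u] by (simp add: M_def)
  have wdeg_w: "wdeg w P = M * wdeg (\<lambda>_. 1) P + wdeg u P" for P
    by (simp add: wdeg_def w_def algebra_simps sum.distrib sum_distrib_left)
  have adm: "admissible_weights w"
  proof -
    have "u i < u j + (M + u k)" for i j k using u_le[of i] by linarith
    then show ?thesis unfolding admissible_weights_def w_def using u_less by (simp add: add.assoc)
  qed
  have least: "wdeg w B < wdeg w P" if "mfps_nth g P \<noteq> 0" "P \<noteq> B" for P
  proof (cases "wdeg (\<lambda>_. 1) P = m")
    case True
    then have "P \<in> S" using that by (simp add: S_def)
    then have "wdeg u B < wdeg u P" using B(2)[of P] t2[of P B] B(1) that(2) by (metis order_le_imp_less_or_eq)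
    then show ?thesis using True B(1) by (simp add: wdeg_w S_def)
  next
    case False
    then have "Suc m \<le> wdeg (\<lambda>_. 1) P" using m(1) that(1) by (auto simp: order_ge_def Suc_le_eq le_neq_implies_less)
    then have "M * Suc m \<le> M * wdeg (\<lambda>_. 1) P" by (rule mult_le_mono2)
    moreover have "wdeg u B < M" by (simp add: M_def)
    ultimately show ?thesis using B(1) by (simp add: wdeg_w S_def)
  qed
  show ?thesis
  proof (rule that[of w "mfps_nth g B" B])
    show "mfps_nth g B \<noteq> 0" using B(1) by (simp add: S_def)
    show "order_ge w (wdeg w B) g" unfolding order_ge_def using least by (metis order.refl order.strict_implies_order)
    show "form w (wdeg w B) g = mfps_const (mfps_nth g B) * monomial B"
      by (rule mfps_eqI) (use least in \<open>force simp: form.rep_eq monomial.rep_eq\<close>)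
  qed (rule adm)
qed

section \<open>Vector fields in normal form\<close>

lemma lie_diff_field: "lie G f - lie H f = lie (G - H) f"
  by (simp add: lie_def sum_subtractf algebra_simps)

lemma normal_form_coeff_axis:
  assumes "poincare_dulac_normal_form lam G"
  shows "mfps_nth (G $ i) (axis i 1) = lam $ i"
proof -
  obtain \<sigma> where "linear_part G = lower_jordan lam \<sigma>"
    using assms by (auto simp: poincare_dulac_normal_form_def)
  then have "linear_part G $ i $ i = lower_jordan lam \<sigma> $ i $ i" by simp
  then show ?thesis by (simp add: linear_part_def lower_jordan_def)
qed

lemma normal_form_coeff_wdeg:
  fixes lam :: "(complex, 'n::{finite,linorder}) vec"
  assumes G: "poincare_dulac_normal_form lam G" and w: "admissible_weights w"
    and nz: "mfps_nth (G $ i) P \<noteq> 0" and P: "P \<noteq> axis i 1"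
  shows "w i < wdeg w P"
proof -
  have "P \<noteq> 0" using G nz by (auto simp: poincare_dulac_normal_form_def)
  then obtain j where "0 < P $ j" by (auto simp: vec_eq_iff)
  then have "\<forall>k. (axis j 1 :: (nat, 'n) vec) $ k \<le> P $ k" by (simp add: axis_def)
  then obtain P' where P': "P = axis j 1 + P'" by (rule vec_nat_le_ex)
  show ?thesis
  proof (cases "P' = 0")
    case True
    obtain \<sigma> where "linear_part G = lower_jordan lam \<sigma>"
      using G by (auto simp: poincare_dulac_normal_form_def)
    then have "linear_part G $ i $ j = lower_jordan lam \<sigma> $ i $ j" by simp
    then have "is_pred j i" using nz P True P'
      by (auto simp: linear_part_def lower_jordan_def split: if_splits)
    then show ?thesis using w P' True
      by (simp add: is_pred_def admissible_weights_def wdeg_axis del: One_nat_def)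
  next
    case False
    then obtain k where "0 < P' $ k" by (auto simp: vec_eq_iff)
    then have "\<forall>l. (axis k 1 :: (nat, 'n) vec) $ l \<le> P' $ l" by (simp add: axis_def)
    then obtain P'' where "P' = axis k 1 + P''" by (rule vec_nat_le_ex)
    then have "wdeg w P = w j + w k + wdeg w P''"
      using P' by (simp add: wdeg_add wdeg_axis del: One_nat_def)
    then show ?thesis using w by (auto simp: admissible_weights_def intro: trans_less_add1)
  qed
qed

text \<open>
  The Jordan and the nonlinear terms of \<open>G\<close> strictly raise the weighted order, so only the semisimple
  part \<open>lam \<odot> x\<close> is visible on leading forms.
\<close>

lemma lie_normal_form_order:
  assumes G: "poincare_dulac_normal_form lam G" and w: "admissible_weights w" and f: "order_ge w a f"
  shows "order_ge w (Suc a) (lie G f - lie (diag_vf lam) f)"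
  unfolding lie_diff_field lie_def[of "G - diag_vf lam"]
proof (rule order_ge_sum)
  fix i
  have GH: "w i < wdeg w A" if "mfps_nth ((G - diag_vf lam) $ i) A \<noteq> 0" for A
  proof -
    have "mfps_nth ((G - diag_vf lam) $ i) A = mfps_nth (G $ i) A - (if A = axis i 1 then lam $ i else 0)"
      by (simp add: diag_vf_def minus_mfps.rep_eq mfps_var.rep_eq)
    then show ?thesis using that normal_form_coeff_wdeg[OF G w, of i A] normal_form_coeff_axis[OF G, of i]
      by (auto split: if_splits)
  qed
  show "order_ge w (Suc a) ((G - diag_vf lam) $ i * mfps_pderiv i f)"
    unfolding order_ge_def
  proof (intro allI impI)
    fix P assume "mfps_nth ((G - diag_vf lam) $ i * mfps_pderiv i f) P \<noteq> 0"
    then obtain A B where AB: "A + B = P" "mfps_nth ((G - diag_vf lam) $ i) A \<noteq> 0"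
        "mfps_nth (mfps_pderiv i f) B \<noteq> 0"
      by (rule mfps_nth_mult_nonzeroE)
    from AB(3) have "mfps_nth f (B + axis i 1) \<noteq> 0" by (auto simp: mfps_pderiv.rep_eq)
    then have "a \<le> wdeg w (B + axis i 1)" using f by (simp add: order_ge_def)
    then have "a \<le> wdeg w B + w i" by (simp add: wdeg_add wdeg_axis del: One_nat_def)
    then show "Suc a \<le> wdeg w P" using GH[OF AB(2)] AB(1) by (auto simp: wdeg_add)
  qed
qed

lemma order_ge_lie_normal_form:
  assumes "poincare_dulac_normal_form lam G" "admissible_weights w" "order_ge w a f"
  shows "order_ge w a (lie G f)"
proof -
  have "order_ge w a ((lie G f - lie (diag_vf lam) f) - (0 - lie (diag_vf lam) f))"
    by (intro order_ge_diff order_ge_mono[OF lie_normal_form_order[OF assms]] order_ge_lie_diag assms)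
       (simp_all add: order_ge_def zero_mfps.rep_eq)
  then show ?thesis by simp
qed

lemma form_lie_normal_form:
  assumes "poincare_dulac_normal_form lam G" "admissible_weights w" "order_ge w a f"
  shows "form w a (lie G f) = lie (diag_vf lam) (form w a f)"
  using lie_normal_form_order[OF assms]
  by (simp add: order_ge_Suc_iff form_diff form_lie_diag)

lemma pairing_shifted_exponent:
  "pairing ((\<chi> k. int (P $ k)) - axis i 1) \<mu> = weight \<mu> P - \<mu> $ i"
proof -
  have "(\<Sum>k\<in>UNIV. of_int (axis i 1 $ k) * \<mu> $ k) = (\<Sum>k\<in>UNIV. if k = i then \<mu> $ i else 0)"
    by (rule sum.cong) (auto simp: axis_def)
  then show ?thesis
    by (simp add: pairing_def weight_def algebra_simps sum_subtractf)
qed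

lemma normal_form_coeff_weight:
  assumes G: "poincare_dulac_normal_form lam G"
    and \<mu>: "\<And>P. pairing P lam = 0 \<Longrightarrow> pairing P \<mu> = 0"
    and "mfps_nth (G $ i) P \<noteq> 0"
  shows "weight \<mu> P = \<mu> $ i"
proof -
  let ?Q = "(\<chi> k. int (P $ k)) - axis i 1"
  have "vf_coeff G ?Q \<noteq> 0" using assms(3) mfps_nth_eq_vf_coeff(2)[of G i P] by auto
  moreover have "?Q \<in> exponents" using mfps_nth_eq_vf_coeff(1)[of P i] by (auto simp: exponents_def)
  ultimately have "pairing ?Q lam = 0" using G by (auto simp: poincare_dulac_normal_form_def M_res_def)
  then have "pairing ?Q \<mu> = 0" by (rule \<mu>)
  then show ?thesis by (simp add: pairing_shifted_exponent)
qed

text \<open>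
  Each term of \<open>G\<close> is resonant for \<open>lam\<close>, hence for \<open>\<mu>\<close>; thus the components of \<open>G\<close> are eigenvectors
  of \<open>lie (diag_vf \<mu>)\<close>, and the eigenvalue \<open>\<mu>\<^sub>i\<close> cancels the shift that \<open>\<partial>\<^sub>i\<close> causes.
\<close>

lemma lie_diag_commute:
  assumes G: "poincare_dulac_normal_form lam G"
    and \<mu>: "\<And>P. pairing P lam = 0 \<Longrightarrow> pairing P \<mu> = 0"
  shows "lie (diag_vf \<mu>) (lie G f) = lie G (lie (diag_vf \<mu>) f)"
proof -
  have 1: "lie (diag_vf \<mu>) (G $ i) = mfps_const (\<mu> $ i) * G $ i" for i
    by (rule mfps_eqI) (use normal_form_coeff_weight[OF G \<mu>] in force)
  have 2: "lie (diag_vf \<mu>) (mfps_pderiv i f)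
      = mfps_pderiv i (lie (diag_vf \<mu>) f) - mfps_const (\<mu> $ i) * mfps_pderiv i f" for i
    by (rule mfps_eqI)
       (simp add: mfps_pderiv.rep_eq minus_mfps.rep_eq weight_add weight_axis del: One_nat_def,
        simp add: algebra_simps)
  show ?thesis
    unfolding lie_def[of G] lie_sum lie_mult 1 2 by (simp add: algebra_simps)
qed

section \<open>Meromorphic first integrals\<close>

text \<open>
  This is the expansion of \<open>f / g\<close> by long division, with the denominators \<open>x\<^sup>C\<close> cleared: modulo terms
  of order \<open>k\<close> and up, \<open>f / g\<close> equals \<open>p / x\<^sup>C\<close>. A division step is possible because the leading form of
  \<open>g\<close> is a monomial, which can be multiplied into the denominator.
\<close>

lemma approximate_quotient:
  fixes f g :: "(complex, 'n::finite) mfps"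
  assumes c: "c \<noteq> 0" and g: "order_ge w (wdeg w B) g" "form w (wdeg w B) g = mfps_const c * monomial B"
  shows "\<exists>C p. order_ge w (k + wdeg w C) (monomial C * f - p * g)"
proof (induction k)
  case 0
  have "order_ge w (0 + wdeg w 0) (monomial 0 * f - 0 * g)" by (simp add: wdeg_def)
  then show ?case by blast
next
  case (Suc k)
  then obtain C p where R: "order_ge w (k + wdeg w C) (monomial C * f - p * g)" by blast
  define R where "R = monomial C * f - p * g"
  define l where "l = k + wdeg w C"
  have R: "order_ge w l R" using R by (simp add: R_def l_def)
  define q where "q = mfps_const (1 / c) * form w l R"
  have q: "order_ge w l q" by (auto simp: q_def order_ge_def form.rep_eq)
  have q_form: "form w l q = q"
    by (rule mfps_eqI) (simp add: q_def form.rep_eq)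
  define R' where "R' = monomial (C + B) * f - (monomial B * p + q) * g"
  have R'_eq: "R' = monomial B * R - q * g"
    by (simp add: R'_def R_def algebra_simps monomial_mult[symmetric])
  have mB: "order_ge w (wdeg w B) (monomial B :: (complex, 'n) mfps)"
    by (simp add: order_ge_def monomial.rep_eq)
  have cc: "mfps_const (1 / c) * mfps_const c = (1 :: (complex, 'n) mfps)"
    using c by (simp add: mfps_const_mult_const[symmetric] mfps_const_1)
  have "order_ge w (wdeg w B + l) R'"
    unfolding R'_eq using order_ge_mult[OF mB R] order_ge_mult[OF q g(1)]
    by (intro order_ge_diff) (simp_all add: add.commute)
  moreover have "form w (wdeg w B + l) R' = 0"
  proof -
    have "form w (wdeg w B + l) (q * g) = q * (mfps_const c * monomial B)"
      using form_mult[OF q g(1)] by (simp add: q_form g(2) add.commute)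
    also have "\<dots> = (mfps_const (1 / c) * mfps_const c) * (monomial B * form w l R)"
      by (simp add: q_def mult_ac)
    finally show ?thesis
      unfolding R'_eq form_diff form_monomial_mult[OF R] cc by simp
  qed
  ultimately have "order_ge w (Suc (wdeg w B + l)) R'" by (simp add: order_ge_Suc_iff)
  then have "order_ge w (Suc k + wdeg w (C + B)) (monomial (C + B) * f - (monomial B * p + q) * g)"
    by (simp add: R'_def l_def wdeg_add add_ac)
  then show ?case by blast
qed

text \<open>
  Here \<open>W / g\<^sup>2\<close> is \<open>D\<^sub>\<mu> (f / g)\<close>. Its leading form has \<open>lam\<close>-weight zero since \<open>L (W / g\<^sup>2) = 0\<close>. On the
  other hand, the approximation \<open>p / x\<^sup>C\<close> of \<open>f / g\<close> shows that this leading form is a component of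
  \<open>D\<^sub>\<mu> (p / x\<^sup>C) = q / x\<^sup>C\<close>, in which the exponents of \<open>\<mu>\<close>-weight zero are missing.
\<close>

lemma invariant_quotient_torus_invariant:
  fixes f g :: "(complex, 'n::{finite,linorder}) mfps"
  assumes G: "poincare_dulac_normal_form lam G"
    and \<mu>: "\<And>P. pairing P lam = 0 \<Longrightarrow> pairing P \<mu> = 0"
    and g: "g \<noteq> 0" and inv: "lie G f * g = f * lie G g"
  shows "lie (diag_vf \<mu>) f * g = f * lie (diag_vf \<mu>) g"
proof (rule ccontr)
  let ?D = "lie (diag_vf \<mu>)" and ?L = "lie G" and ?S = "lie (diag_vf lam)"
  define W where "W = ?D f * g - f * ?D g"
  assume "?D f * g \<noteq> f * ?D g"
  then have "W \<noteq> 0" by (simp add: W_def)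
  obtain w c B where w: "admissible_weights w" and c: "c \<noteq> 0"
    and gB: "order_ge w (wdeg w B) g" "form w (wdeg w B) g = mfps_const c * monomial B"
    using exists_weights_monomial_leading_form[OF g] .
  obtain a where a: "order_ge w a W" "form w a W \<noteq> 0"
    using exists_leading_form[OF \<open>W \<noteq> 0\<close>] .
  define b where "b = wdeg w B"
  define gb where "gb = form w b g"
  have gb: "gb = mfps_const c * monomial B" "gb \<noteq> 0"
    using gB c by (simp_all add: gb_def b_def)
  have Sgb: "?S gb = mfps_const (weight lam B) * gb"
    by (simp add: gb(1) lie_diag_const_mult lie_diag_monomial mult_ac)
  have gB1: "order_ge w b g" using gB(1) by (simp add: b_def)

  (* L (W / g^2) = 0, cleared of denominators *)
  have LW: "?L W * g = W * ?L g + W * ?L g"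
  proof -
    have DLf: "?D (?L f) * g = ?D f * ?L g + f * ?D (?L g) - ?L f * ?D g"
      using arg_cong[OF inv, of ?D] unfolding lie_mult eq_diff_eq .
    have "?L W = ?D (?L f) * g + ?D f * ?L g - ?L f * ?D g - f * ?D (?L g)"
      by (simp add: W_def lie_diff lie_mult lie_diag_commute[OF G \<mu>])
    then have "?L W = (?D f * ?L g + ?D f * ?L g) - (?L f * ?D g + ?L f * ?D g)"
      unfolding DLf by (simp add: algebra_simps)
    then have "?L W * g = (?D f * ?L g + ?D f * ?L g) * g - (?L f * g * ?D g + ?L f * g * ?D g)"
      by (simp only: left_diff_distrib right_diff_distrib distrib_left distrib_right mult_ac)
    also have "\<dots> = W * ?L g + W * ?L g" unfolding inv W_def by (simp add: algebra_simps)
    finally show ?thesis .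
  qed
  have SW: "?S (form w a W) = mfps_const (weight lam (B + B)) * form w a W"
  proof -
    have "form w (a + b) (?L W * g) = ?S (form w a W) * gb"
      using form_mult[OF order_ge_lie_normal_form[OF G w a(1)] gB1]
      by (simp add: form_lie_normal_form[OF G w a(1)] gb_def)
    moreover have "form w (a + b) (W * ?L g) = form w a W * ?S gb"
      using form_mult[OF a(1) order_ge_lie_normal_form[OF G w gB1]]
      by (simp add: form_lie_normal_form[OF G w gB1] gb_def)
    ultimately have "?S (form w a W) * gb = form w a W * ?S gb + form w a W * ?S gb"
      unfolding LW form_add by simp
    also have "\<dots> = mfps_const (weight lam (B + B)) * form w a W * gb"
      unfolding Sgb weight_add mfps_const_add by (simp add: algebra_simps)
    finally show ?thesis using gb(2) by simp
  qed

  (* One order beyond that of W, so that the remainder cannot reach the leading form of x^C W. *)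
  obtain C p where R0: "order_ge w (Suc a + wdeg w C) (monomial C * f - p * g)"
    using approximate_quotient[OF c gB, of "Suc a"] by blast
  define R where "R = monomial C * f - p * g"
  define m where "m = wdeg w C + a"
  have R: "order_ge w (Suc m) R" using R0 by (simp add: R_def m_def add_ac)
  let ?k = "mfps_const (weight \<mu> C) :: (complex, 'n) mfps"
  define q where "q = ?D p - ?k * p"
  define E where "E = ?D R * g - ?k * (R * g) - R * ?D g"
  have decomp: "monomial C * W = E + q * (g * g)"
  proof -
    have Cf: "monomial C * f = R + p * g" by (simp add: R_def)
    have "monomial C * W = (?D (monomial C * f) - ?k * (monomial C * f)) * g - (monomial C * f) * ?D g"
      by (simp add: W_def lie_mult lie_diag_monomial algebra_simps)
    also have "\<dots> = E + q * (g * g)"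
      unfolding Cf by (simp add: lie_add lie_mult E_def q_def algebra_simps)
    finally show ?thesis .
  qed
  have "order_ge w (Suc m) E"
  proof -
    have "order_ge w (Suc m + 0) (?D R * g)" "order_ge w (Suc m + 0) (R * ?D g)"
      "order_ge w (0 + (Suc m + 0)) (?k * (R * g))"
      by (intro order_ge_mult order_ge_lie_diag R order_ge_0)+
    then show ?thesis unfolding E_def by (simp add: order_ge_diff)
  qed
  then have E0: "form w k E = 0" if "k \<le> m" for k
    using that by (auto intro: form_eq_0)
  have CW: "order_ge w m (monomial C * W)" "form w m (monomial C * W) = monomial C * form w a W"
    using order_ge_mult[OF _ a(1), of "wdeg w C" "monomial C"] form_monomial_mult[OF a(1), of C]
    by (simp_all add: m_def order_ge_def monomial.rep_eq)
  have qgg: "form w k (q * (g * g)) = form w k (monomial C * W)" if "k \<le> m" for k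
    using E0[OF that] by (simp add: decomp form_add)
  have "q \<noteq> 0"
    using qgg[of m] CW(2) a(2) form_diff[of w m "0 :: (complex, 'n) mfps" 0] by auto
  then obtain e where e: "order_ge w e q" "form w e q \<noteq> 0" using exists_leading_form by blast
  have lead: "form w (e + (b + b)) (q * (g * g)) = form w e q * (gb * gb)"
    using form_mult[OF e(1) order_ge_mult[OF gB1 gB1]] form_mult[OF gB1 gB1] by (simp add: gb_def)
  have ord: "order_ge w (e + (b + b)) (q * (g * g))"
    by (intro order_ge_mult e gB1)
  (* x^C W and q g^2 agree up to order m, where x^C W has its leading form. *)
  have "e + (b + b) = m"
  proof (rule linorder_cases)
    assume "e + (b + b) < m"
    then have "form w e q * (gb * gb) = 0" using qgg[of "e + (b + b)"] CW(1) by (simp add: lead form_eq_0)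
    then show ?thesis using e gb by simp
  next
    assume "m < e + (b + b)"
    then have "monomial C * form w a W = 0" using ord qgg[of m] CW(2) by (simp add: form_eq_0)
    then show ?thesis using a by simp
  qed
  then have eq: "form w e q * (gb * gb) = monomial C * form w a W"
    using lead qgg[of m] CW(2) by simp
  have "?S (form w e q) = mfps_const (weight lam C) * form w e q"
  proof -
    have "?S (form w e q) * (gb * gb) + form w e q * (?S gb * gb + gb * ?S gb)
        = mfps_const (weight lam C) * monomial C * form w a W + monomial C * ?S (form w a W)"
      using arg_cong[OF eq, of ?S] unfolding lie_mult lie_diag_monomial .
    also have "\<dots> = (mfps_const (weight lam C) + mfps_const (weight lam B) + mfps_const (weight lam B))
        * (form w e q * (gb * gb))"
      unfolding SW eq weight_add mfps_const_add by (simp add: algebra_simps)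
    finally have "?S (form w e q) * (gb * gb) = mfps_const (weight lam C) * form w e q * (gb * gb)"
      unfolding Sgb by (simp add: algebra_simps)
    then show ?thesis using gb(2) by simp
  qed
  then have wC: "weight lam P = weight lam C" if "mfps_nth (form w e q) P \<noteq> 0" for P
    using that by (metis mfps_nth_const_mult mfps_nth_lie_diag mult_right_cancel)
  have "mfps_nth (form w e q) P = 0" for P
  proof (rule ccontr)
    assume nz: "mfps_nth (form w e q) P \<noteq> 0"
    have pw: "pairing (\<chi> i. int (P $ i) - int (C $ i)) \<nu> = weight \<nu> P - weight \<nu> C" for \<nu>
      by (simp add: pairing_def weight_def algebra_simps sum_subtractf)
    have "weight \<mu> P = weight \<mu> C"
      using \<mu>[of "\<chi> i. int (P $ i) - int (C $ i)"] wC[OF nz] by (simp add: pw)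
    then have "mfps_nth q P = 0" by (simp add: q_def minus_mfps.rep_eq)
    then show False using nz by (simp add: form.rep_eq split: if_splits)
  qed
  then show False using e(2) by (auto simp: mfps_eq_iff zero_mfps.rep_eq)
qed

lemma first_integral_Fract_iff:
  fixes f g :: "(complex, 'n::finite) mfps"
  assumes "g \<noteq> 0"
  shows "first_integral G (Fract f g) \<longleftrightarrow> lie G f * g = f * lie G g"
proof -
  have sum_Fract: "(\<Sum>i\<in>I. Fract (h i) (g * g)) = Fract (\<Sum>i\<in>I. h i) (g * g)"
    for h :: "'n \<Rightarrow> (complex, 'n) mfps" and I
  proof (induction I rule: infinite_finite_induct)
    case (insert x F)
    then show ?case using assms by (simp add: eq_fract algebra_simps)
  qed (use assms in \<open>simp_all add: Zero_fract_def eq_fract\<close>)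
  have "(\<Sum>i\<in>UNIV. mero_gradient (Fract f g) $ i * to_fract (G $ i))
      = (\<Sum>i\<in>UNIV. Fract ((mfps_pderiv i f * g - f * mfps_pderiv i g) * G $ i) (g * g))"
    using assms by (simp add: mero_gradient_def mero_pderiv_Fract to_fract_def)
  also have "\<dots> = Fract (lie G f * g - f * lie G g) (g * g)"
    unfolding sum_Fract
    by (rule arg_cong[of _ _ "\<lambda>h. Fract h (g * g)"])
       (simp add: lie_def sum_distrib_left sum_distrib_right sum_subtractf algebra_simps)
  finally show ?thesis unfolding first_integral_def using assms
    by (simp add: Zero_fract_def eq_fract)
qed

lemma first_integral_torus:
  fixes lam :: "(complex, 'n::{finite,linorder}) vec"
  assumes "poincare_dulac_normal_form lam G" "\<And>P. pairing P lam = 0 \<Longrightarrow> pairing P \<mu> = 0"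
    "first_integral G \<psi>"
  shows "first_integral (diag_vf \<mu>) \<psi>"
proof (cases \<psi>)
  case (Fract f g)
  then show ?thesis
    using assms invariant_quotient_torus_invariant[OF assms(1,2), of g f]
    by (simp add: first_integral_Fract_iff)
qed

text \<open>
  The coefficient of \<open>x\<^sub>j\<^sup>m\<close> when a series is read as a power series in \<open>x\<^sub>j\<close> alone.
\<close>

lift_definition slice :: "'n::finite \<Rightarrow> nat \<Rightarrow> ('a::zero, 'n) mfps \<Rightarrow> ('a, 'n) mfps"
  is "\<lambda>j m f P. if P $ j = 0 then f (P + axis j m) else 0" .

lemma mfps_free_of_slice: "mfps_free_of j (slice j m f)"
  by (simp add: mfps_free_of_def slice.rep_eq)

lemma wdeg_indicator: "wdeg (\<lambda>i. if i = j then 1 else 0) P = P $ j"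
proof -
  have "wdeg (\<lambda>i. if i = j then 1 else 0) P = (\<Sum>i\<in>UNIV. if i = j then P $ j else 0)"
    unfolding wdeg_def by (rule sum.cong) auto
  then show ?thesis by simp
qed

text \<open>
  For the weight that counts only \<open>x\<^sub>j\<close>, the form of degree \<open>m\<close> is \<open>x\<^sub>j\<^sup>m\<close> times a series without \<open>x\<^sub>j\<close>.
\<close>

lemma form_eq_slice:
  fixes f :: "('a::comm_ring_1, 'n::finite) mfps"
  shows "form (\<lambda>i. if i = j then 1 else 0) m f = monomial (axis j m) * slice j m f"
proof (rule mfps_eqI)
  fix P
  show "mfps_nth (form (\<lambda>i. if i = j then 1 else 0) m f) P = mfps_nth (monomial (axis j m) * slice j m f) P"
  proof (cases "\<forall>k. axis j m $ k \<le> P $ k")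
    case True
    then obtain C where C: "P = axis j m + C" by (rule vec_nat_le_ex)
    have "P $ j = m \<longleftrightarrow> C $ j = 0" by (simp add: C axis_def)
    then show ?thesis
      unfolding C mfps_nth_monomial_mult by (simp add: form.rep_eq wdeg_indicator slice.rep_eq add.commute C)
  next
    case False
    then have "P $ j \<noteq> m" by (auto simp: axis_def split: if_splits)
    with False show ?thesis by (simp add: form.rep_eq wdeg_indicator mfps_nth_monomial_mult_eq_0)
  qed
qed

text \<open>
  Compare lowest powers of \<open>x\<^sub>j\<close> in \<open>x\<^sub>j \<partial>\<^sub>j f \<cdot> g = f \<cdot> x\<^sub>j \<partial>\<^sub>j g\<close>: numerator and denominator start with
  the same power \<open>m\<close>. The same comparison applied to \<open>h = f g\<^sub>m - g f\<^sub>m\<close> says that \<open>h\<close> could start only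
  in degree \<open>2 m\<close>, where its terms cancel. So \<open>f / g = f\<^sub>m / g\<^sub>m\<close>, and \<open>x\<^sub>j\<^sup>m\<close> cancels.
\<close>

lemma Euler_invariant_mero_free_of:
  fixes \<psi> :: "'n::finite meromorphic"
  assumes "first_integral (diag_vf (axis j 1)) \<psi>"
  shows "mero_free_of j \<psi>"
proof (cases \<psi>)
  case (Fract f g)
  let ?w = "\<lambda>i. if i = j then 1 else 0 :: nat" and ?D = "lie (diag_vf (axis j 1))"
  have weight: "weight (axis j 1) P = of_nat (P $ j)" for P :: "nat ^ 'n"
  proof -
    have "weight (axis j 1) P = (\<Sum>i\<in>UNIV. if i = j then of_nat (P $ j) else 0)"
      unfolding weight_def by (rule sum.cong) (auto simp: axis_def)
    then show ?thesis by simp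
  qed
  have Dform: "?D (form ?w k h) = mfps_const (of_nat k) * form ?w k h" for k h
    by (rule mfps_eqI) (simp add: form.rep_eq weight wdeg_indicator)
  have inv: "?D f * g = f * ?D g"
    using assms Fract first_integral_Fract_iff by metis
  obtain m where m: "order_ge ?w m g" "form ?w m g \<noteq> 0"
    using exists_leading_form[OF \<open>g \<noteq> 0\<close>] .
  define gm fm where "gm = form ?w m g" and "fm = form ?w m f"
  have Dgm: "?D gm = mfps_const (of_nat m) * gm" and Dfm: "?D fm = mfps_const (of_nat m) * fm"
    by (simp_all only: gm_def fm_def Dform)
  (* The hypothesis says that x_j d_j (h / g) = n h / g; it is used with n = 0 for f and n = m for h. *)
  have order: "k = n + m" if "order_ge ?w k h" "form ?w k h \<noteq> 0"
    "?D h * g = mfps_const (of_nat n) * h * g + h * ?D g" for k n h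
  proof -
    have "form ?w (k + m) (?D h * g) = mfps_const (of_nat k) * form ?w k h * gm"
      using form_mult[OF order_ge_lie_diag[OF that(1)] m(1)] by (simp add: form_lie_diag Dform gm_def)
    moreover have "form ?w (k + m) (h * ?D g) = form ?w k h * (mfps_const (of_nat m) * gm)"
      using form_mult[OF that(1) order_ge_lie_diag[OF m(1)]] by (simp add: form_lie_diag Dform gm_def)
    moreover have "form ?w (k + m) (mfps_const (of_nat n) * (h * g)) = mfps_const (of_nat n) * (form ?w k h * gm)"
      unfolding gm_def form_mult[OF that(1) m(1), symmetric] by (rule mfps_eqI) (simp add: form.rep_eq)
    ultimately have "(mfps_const (of_nat k) - mfps_const (of_nat n) - mfps_const (of_nat m)) * (form ?w k h * gm) = 0"
      using that(3) by (simp add: form_add algebra_simps)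
    then have "mfps_const (of_nat k) = (mfps_const (of_nat n + of_nat m) :: (complex, 'n) mfps)"
      using that(2) m(2) by (simp add: gm_def mfps_const_add) (simp add: algebra_simps)
    then have "(of_nat k :: complex) = of_nat (n + m)"
      by (metis mfps_const.rep_eq of_nat_add)
    then show ?thesis by (simp only: of_nat_eq_iff)
  qed
  have f: "order_ge ?w m f"
  proof (cases "f = 0")
    case True
    then show ?thesis by (simp add: order_ge_def zero_mfps.rep_eq)
  next
    case False
    then obtain k where k: "order_ge ?w k f" "form ?w k f \<noteq> 0" using exists_leading_form by blast
    then have "k = 0 + m" by (rule order) (simp add: inv mfps_const_0)
    then show ?thesis using k by simp
  qed
  define h where "h = f * gm - g * fm"
  have "h = 0"
  proof (rule ccontr)
    assume "h \<noteq> 0"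
    then obtain k where k: "order_ge ?w k h" "form ?w k h \<noteq> 0" using exists_leading_form by blast
    have "?D h * g = (?D f * g) * gm - g * ?D g * fm + mfps_const (of_nat m) * h * g"
      by (simp add: h_def lie_diff lie_mult Dgm Dfm algebra_simps)
    also have "\<dots> = mfps_const (of_nat m) * h * g + h * ?D g"
      unfolding inv h_def by (simp add: algebra_simps)
    finally have "k = m + m" using order[OF k] by blast
    moreover have "form ?w (m + m) h = 0"
      using form_mult[OF f order_ge_form, of m g] form_mult[OF m(1) order_ge_form, of m f]
      by (simp add: h_def form_diff gm_def fm_def)
    ultimately show False using k by simp
  qed
  then have "f * gm = fm * g" by (simp add: h_def mult.commute)
  then have "monomial (axis j m) * (f * slice j m g) = monomial (axis j m) * (slice j m f * g)"
    by (simp add: gm_def fm_def form_eq_slice algebra_simps)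
  then have "f * slice j m g = slice j m f * g" by simp
  moreover have "slice j m g \<noteq> 0" using m(2) by (auto simp: form_eq_slice)
  ultimately have "Fract f g = Fract (slice j m f) (slice j m g)"
    using \<open>g \<noteq> 0\<close> by (simp add: eq_fract)
  then show ?thesis
    unfolding mero_free_of_def using Fract \<open>slice j m g \<noteq> 0\<close> mfps_free_of_slice by blast
qed



section \<open>Linear algebra\<close>

text \<open>
  Extend a basis of \<open>U\<close> to a basis of the whole space and use its elements as rows of a matrix. The
  matrix is injective and maps \<open>V\<close> into the coordinate subspace that vanishes on the rows from \<open>U\<close>.
\<close>

lemma dim_orthogonal_le:
  fixes U V :: "('a::field ^ 'n::finite) set"
  assumes orth: "\<And>u v. u \<in> U \<Longrightarrow> v \<in> V \<Longrightarrow> (\<Sum>i\<in>UNIV. v $ i * u $ i) = 0"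
  shows "vec.dim U + vec.dim V \<le> CARD('n)"
proof -
  obtain B where B: "B \<subseteq> U" "vec.independent B" "U \<subseteq> vec.span B" "card B = vec.dim U"
    using vec.basis_exists[of U] .
  obtain B' where B': "B \<subseteq> B'" "B' \<subseteq> UNIV" "vec.independent B'" "UNIV \<subseteq> vec.span B'"
    using vec.maximal_independent_subset_extend[OF subset_UNIV B(2)] .
  have B': "B \<subseteq> B'" "vec.independent B'" "vec.span B' = UNIV" using B' by blast+
  have "finite B'" using B'(2) by (rule vec.finiteI_independent)
  have "card B' = CARD('n)" using vec.basis_card_eq_dim[of B' UNIV] B'(2,3)
    unfolding vec_dim_card by simp
  then obtain \<beta> where \<beta>: "bij_betw \<beta> (UNIV :: 'n set) B'"
    using finite_same_card_bij[OF finite_class.finite_UNIV \<open>finite B'\<close>] by auto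
  define A where "A = (\<chi> i. \<beta> i)"
  have Av: "(A *v v) $ i = (\<Sum>k\<in>UNIV. \<beta> i $ k * v $ k)" for v i
    by (simp add: A_def matrix_vector_mult_def)
  have inj: "inj ((*v) A)"
  proof (rule injI)
    fix x y assume "A *v x = A *v y"
    then have "A *v (x - y) = 0" by (simp add: matrix_vector_mult_diff_distrib)
    then have *: "(\<Sum>k\<in>UNIV. \<beta> i $ k * (x - y) $ k) = 0" for i using Av[of "x - y" i] by simp
    have "(\<Sum>k\<in>UNIV. b $ k * (x - y) $ k) = 0" if "b \<in> vec.span B'" for b
      using that
    proof (induction rule: vec.span_induct_alt)
      case (step c b y')
      then obtain i where "b = \<beta> i" using \<beta> by (auto simp: bij_betw_def)
      then show ?case using *[of i] step(2)
        by (simp add: distrib_right sum.distrib mult.assoc sum_distrib_left[symmetric] del: vector_minus_component)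
    qed simp
    then have "(\<Sum>k\<in>UNIV. axis i 1 $ k * (x - y) $ k) = 0" for i
      unfolding B'(3) by blast
    moreover have "(\<Sum>k\<in>UNIV. axis i 1 $ k * (x - y) $ k) = (\<Sum>k\<in>UNIV. if k = i then (x - y) $ i else 0)" for i
      by (rule sum.cong) (auto simp: axis_def)
    ultimately show "x = y" by (simp add: vec_eq_iff)
  qed
  have "vec.dim ((*v) A ` V) = vec.dim V"
    by (rule vec.dim_image_eq) (auto intro: inj_on_subset[OF inj] matrix_vector_mul_linear_gen)
  moreover have "vec.dim ((*v) A ` V) \<le> card {i. \<beta> i \<notin> B}"
    unfolding dim_substandard_cart[symmetric, where 'a = 'a]
  proof (rule vec.dim_subset, rule image_subsetI)
    fix v assume "v \<in> V"
    then have "(A *v v) $ i = 0" if "\<beta> i \<in> B" for i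
      using orth[of "\<beta> i" v] B(1) that by (auto simp: Av mult.commute)
    then show "A *v v \<in> {x. \<forall>i. i \<notin> {i. \<beta> i \<notin> B} \<longrightarrow> x $ i = 0}" by simp
  qed
  moreover have "card {i. \<beta> i \<notin> B} + card B = CARD('n)"
  proof -
    have "card {i. \<beta> i \<in> B} = card B"
    proof (rule bij_betw_same_card[of \<beta>])
      have "\<beta> ` {i. \<beta> i \<in> B} = range \<beta> \<inter> B" by auto
      then have "\<beta> ` {i. \<beta> i \<in> B} = B" using \<beta> B'(1) by (auto simp: bij_betw_def)
      then show "bij_betw \<beta> {i. \<beta> i \<in> B} B"
        using \<beta> by (auto simp: bij_betw_def intro: inj_on_subset)
    qed
    moreover have "card {i. \<beta> i \<notin> B} + card {i. \<beta> i \<in> B} = CARD('n)"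
      using card_Diff_subset[of "{i. \<beta> i \<in> B}" UNIV] card_mono[of UNIV "{i. \<beta> i \<in> B}"]
      by (simp add: Compl_eq_Diff_UNIV[symmetric] Collect_neg_eq[symmetric])
    ultimately show ?thesis by simp
  qed
  ultimately show ?thesis using B(4) by linarith
qed

text \<open>
  A rational relation becomes an integral one after clearing denominators. The bound makes the maximum
  in \<open>lattice_rank\<close> range over a finite set.
\<close>

lemma zvec_independent_card_le:
  assumes "zvec.independent (B :: (int ^ 'n::finite) set)"
  shows "card B \<le> CARD('n)"
proof (rule ccontr)
  assume *: "\<not> card B \<le> CARD('n)"
  then have "finite B" by (metis card.infinite le0)
  define \<iota> :: "int ^ 'n \<Rightarrow> rat ^ 'n" where "\<iota> v = (\<chi> i. of_int (v $ i))" for v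
  have "inj \<iota>" by (rule injI) (simp add: \<iota>_def vec_eq_iff)
  then have "card (\<iota> ` B) = card B" using card_image inj_on_subset by blast
  then have "vec.dependent (\<iota> ` B)"
    using * vec.dim_eq_card_independent[of "\<iota> ` B"] dim_subset_UNIV_cart_gen[of "\<iota> ` B"] by force
  then obtain u b0 where u: "(\<Sum>v\<in>\<iota> ` B. u v *s v) = 0" "b0 \<in> B" "u (\<iota> b0) \<noteq> 0"
    using vec.dependent_finite[of "\<iota> ` B"] \<open>finite B\<close> by auto
  have 0: "(\<Sum>b\<in>B. u (\<iota> b) * of_int (b $ i)) = 0" for i
  proof -
    have "(\<Sum>b\<in>B. u (\<iota> b) *s \<iota> b) = 0"
      using u(1) by (subst (asm) sum.reindex) (use \<open>inj \<iota>\<close> in \<open>auto intro: inj_on_subset\<close>)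
    then have "(\<Sum>b\<in>B. u (\<iota> b) *s \<iota> b) $ i = 0" by simp
    then show ?thesis by (simp add: \<iota>_def sum_component)
  qed
  define den where "den b = snd (quotient_of (u (\<iota> b)))" for b
  define num where "num b = fst (quotient_of (u (\<iota> b)))" for b
  have den: "den b > 0" "u (\<iota> b) = of_int (num b) / of_int (den b)" for b
    by (simp_all add: den_def num_def quotient_of_denom_pos' quotient_of_div)
  define N where "N = (\<Prod>b\<in>B. den b)"
  define z where "z b = num b * (\<Prod>b'\<in>B - {b}. den b')" for b
  have "N > 0" using den by (simp add: N_def prod_pos)
  have z: "of_int (z b) = of_int N * u (\<iota> b)" if "b \<in> B" for b
    using den[of b] prod.remove[OF \<open>finite B\<close> that, of den]
    by (simp add: z_def N_def field_simps)
  have "(\<Sum>b\<in>B. z b * b $ i) = 0" for i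
  proof -
    have "(of_int (\<Sum>b\<in>B. z b * b $ i) :: rat) = (\<Sum>b\<in>B. of_int N * (u (\<iota> b) * of_int (b $ i)))"
      unfolding of_int_sum of_int_mult by (rule sum.cong) (simp_all add: z mult.assoc)
    also have "\<dots> = 0" unfolding sum_distrib_left[symmetric] 0 by simp
    finally show ?thesis unfolding of_int_eq_0_iff .
  qed
  then have "(\<Sum>b\<in>B. z b *s b) = 0" by (simp add: vec_eq_iff sum_component)
  then have "z b0 = 0"
    using zvec.independentD[OF assms \<open>finite B\<close> order.refl] u(2) by blast
  then show False using z[OF u(2)] u(3) \<open>N > 0\<close> by simp
qed

lemma card_le_lattice_rank:
  assumes "B \<subseteq> S" "zvec.independent B"
  shows "card B \<le> lattice_rank S"
  unfolding lattice_rank_def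
proof (rule Max_ge)
  show "finite {card B |B. B \<subseteq> S \<and> zvec.independent B}"
    by (rule finite_subset[of _ "{..CARD('a)}"]) (auto intro: zvec_independent_card_le)
qed (use assms in blast)

lemma independent_family_left_inverse:
  fixes \<Lambda> :: "'r::finite \<Rightarrow> complex ^ 'n::finite"
  assumes "inj \<Lambda>" "vec.independent (range \<Lambda>)"
  shows "\<exists>L :: 'r \<Rightarrow> complex ^ 'n.
    \<forall>j k. (\<Sum>i\<in>UNIV. L j $ i * \<Lambda> k $ i) = (if j = k then 1 else 0)"
proof -
  define A where "A = (\<chi> i k. \<Lambda> k $ i)"
  have col: "column k A = \<Lambda> k" for k by (simp add: A_def column_def vec_eq_iff)
  have "\<forall>k. c k = 0" if "(\<Sum>k\<in>UNIV. c k *s column k A) = 0" for c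
  proof
    fix k
    have "(\<Sum>v\<in>range \<Lambda>. c (inv \<Lambda> v) *s v) = 0"
      using that assms(1) by (simp add: sum.reindex col)
    then have "c (inv \<Lambda> (\<Lambda> k)) = 0"
      using vec.independentD[OF assms(2), of "range \<Lambda>" "\<lambda>v. c (inv \<Lambda> v)" "\<Lambda> k"] by simp
    then show "c k = 0" using assms(1) by simp
  qed
  then obtain M where M: "M ** A = mat 1"
    using matrix_left_invertible_independent_columns[of A] by blast
  show ?thesis
  proof (intro exI[of _ "\<lambda>j. M $ j"] allI)
    fix j k
    have "(M ** A) $ j $ k = (if j = k then 1 else 0)" unfolding M by (simp add: mat_def)
    then show "(\<Sum>i\<in>UNIV. M $ j $ i * \<Lambda> k $ i) = (if j = k then 1 else 0)"
      by (simp add: matrix_matrix_mult_def A_def)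
  qed
qed

section \<open>The torus fields over the meromorphic functions\<close>

definition const_mero :: "complex \<Rightarrow> 'n::finite meromorphic" where
  "const_mero c = to_fract (mfps_const c)"

lemma const_mero_mult: "const_mero (a * b) = const_mero a * const_mero b"
  by (simp add: const_mero_def mfps_const_mult_const)

lemma const_mero_add: "const_mero (a + b) = const_mero a + const_mero b"
  by (simp add: const_mero_def mfps_const_add)

lemma const_mero_sum: "const_mero (\<Sum>i\<in>I. f i) = (\<Sum>i\<in>I. const_mero (f i))"
  by (induction I rule: infinite_finite_induct)
     (simp_all add: const_mero_def mfps_const_0 mfps_const_add)

lemma const_mero_0 [simp]: "const_mero 0 = 0" and const_mero_1 [simp]: "const_mero 1 = 1"
  by (simp_all add: const_mero_def mfps_const_0 mfps_const_1)

lemma const_mero_minus: "const_mero (- a) = - const_mero a"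
  using const_mero_add[of "- a" a] by (simp add: eq_neg_iff_add_eq_0)

definition var_mero :: "'n \<Rightarrow> 'n::finite meromorphic" where
  "var_mero i = to_fract (mfps_var i)"

lemma var_mero_neq_0 [simp]: "var_mero i \<noteq> 0"
  by (simp add: var_mero_def mfps_var_eq_monomial)

lemma to_mero_vec_diag: "to_mero_vec (diag_vf v) $ i = const_mero (v $ i) * var_mero i"
  by (simp add: to_mero_vec_def diag_vf_def const_mero_def var_mero_def)

text \<open>
  A constant left inverse survives the passage to meromorphic functions; so constant vectors that are
  independent over the complex numbers stay independent over that field.
\<close>

lemma left_inverse_mero:
  fixes L \<Lambda> :: "'r::finite \<Rightarrow> complex ^ 'n::finite"
  assumes "\<And>j k. (\<Sum>i\<in>UNIV. L j $ i * \<Lambda> k $ i) = (if j = k then 1 else 0)"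
  shows "(\<Sum>i\<in>UNIV. const_mero (L j $ i) / var_mero i * to_mero_vec (diag_vf (\<Lambda> k)) $ i)
    = (if j = k then 1 else 0)"
proof -
  have "(\<Sum>i\<in>UNIV. const_mero (L j $ i) / var_mero i * to_mero_vec (diag_vf (\<Lambda> k)) $ i)
      = (const_mero (\<Sum>i\<in>UNIV. L j $ i * \<Lambda> k $ i) :: 'n meromorphic)"
    unfolding const_mero_sum const_mero_mult by (rule sum.cong) (simp_all add: to_mero_vec_diag)
  then show ?thesis by (simp add: assms)
qed

lemma inj_torus_fields:
  fixes \<Lambda> :: "'r::finite \<Rightarrow> complex ^ 'n::finite"
  assumes "inj \<Lambda>" "vec.independent (range \<Lambda>)"
  shows "inj (\<lambda>j. to_mero_vec (diag_vf (\<Lambda> j)))"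
proof (rule injI, rule ccontr)
  obtain L where L: "\<And>j k. (\<Sum>i\<in>UNIV. L j $ i * \<Lambda> k $ i) = (if j = k then 1 else 0)"
    using independent_family_left_inverse[OF assms] by blast
  fix j k assume "to_mero_vec (diag_vf (\<Lambda> j)) = to_mero_vec (diag_vf (\<Lambda> k))" "j \<noteq> k"
  then have "(1 :: 'n meromorphic) = 0"
    using left_inverse_mero[OF L, of j j] left_inverse_mero[OF L, of j k] by simp
  then show False by simp
qed

lemma dim_torus_fields:
  fixes \<Lambda> :: "'r::finite \<Rightarrow> complex ^ 'n::finite"
  assumes "inj \<Lambda>" "vec.independent (range \<Lambda>)"
  shows "vec.dim (range (\<lambda>j. to_mero_vec (diag_vf (\<Lambda> j)))) = CARD('r)"
proof -
  obtain L where L: "\<And>j k. (\<Sum>i\<in>UNIV. L j $ i * \<Lambda> k $ i) = (if j = k then 1 else 0)"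
    using independent_family_left_inverse[OF assms] by blast
  let ?u = "\<lambda>j. to_mero_vec (diag_vf (\<Lambda> j))"
  have zero: "c k = 0" if "(\<Sum>j\<in>UNIV. c j *s ?u j) = 0" for c k
  proof -
    have "0 = (\<Sum>i\<in>UNIV. const_mero (L k $ i) / var_mero i * (\<Sum>j\<in>UNIV. c j *s ?u j) $ i)"
      unfolding that by simp
    also have "\<dots> = (\<Sum>i\<in>UNIV. \<Sum>j\<in>UNIV. c j * (const_mero (L k $ i) / var_mero i * ?u j $ i))"
      by (simp add: sum_component sum_distrib_left mult_ac)
    also have "\<dots> = (\<Sum>j\<in>UNIV. c j * (\<Sum>i\<in>UNIV. const_mero (L k $ i) / var_mero i * ?u j $ i))"
      by (subst sum.swap) (simp add: sum_distrib_left)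
    also have "\<dots> = (\<Sum>j\<in>UNIV. if k = j then c j else 0)"
      unfolding left_inverse_mero[OF L] by (rule sum.cong) auto
    also have "\<dots> = c k" by simp
    finally show ?thesis by simp
  qed
  have inj: "inj ?u" by (rule inj_torus_fields[OF assms])
  have "vec.independent (range ?u)"
  proof (rule vec.independent_if_scalars_zero)
    fix f v assume f: "(\<Sum>v\<in>range ?u. f v *s v) = 0" and "v \<in> range ?u"
    then obtain k where "v = ?u k" by blast
    have "(\<Sum>j\<in>UNIV. f (?u j) *s ?u j) = 0" using f inj by (simp add: sum.reindex)
    then show "f v = 0" using zero[of "\<lambda>j. f (?u j)" k] \<open>v = ?u k\<close> by simp
  qed simp
  then show ?thesis using inj by (simp add: vec.dim_eq_card_independent card_image)
qed

text \<open>
  If \<open>P\<^sub>j \<noteq> 0\<close>, the relation \<open>\<Sum>i. P\<^sub>i \<Lambda> k\<^sub>i = 0\<close> solves row \<open>j\<close> of the matrix in terms of the other rows,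
  up to the factors \<open>x\<^sub>i\<close>. The other rows then span as much as all rows, which is everything by the left
  inverse.
\<close>

lemma exceptional_index_exponent_0:
  fixes \<Lambda> :: "'r::finite \<Rightarrow> complex ^ 'n::finite"
  assumes ind: "inj \<Lambda>" "vec.independent (range \<Lambda>)" and exc: "exceptional_index \<Lambda> j"
    and P: "\<And>k. pairing P (\<Lambda> k) = 0"
  shows "P $ j = 0"
proof (rule ccontr)
  assume Pj: "P $ j \<noteq> 0"
  obtain L where L: "\<And>j k. (\<Sum>i\<in>UNIV. L j $ i * \<Lambda> k $ i) = (if j = k then 1 else 0)"
    using independent_family_left_inverse[OF ind] by blast
  let ?A = "column_matrix \<Lambda> :: 'n meromorphic ^ 'r ^ 'n"
  define V where "V = vec.span {row i ?A | i. i \<noteq> j}"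
  have A: "row i ?A $ k = const_mero (\<Lambda> k $ i) * var_mero i" for i k
    by (simp add: row_def column_matrix_def to_mero_vec_diag)
  have other: "row i ?A \<in> V" if "i \<noteq> j" for i
    unfolding V_def using that by (intro vec.span_base) blast
  have "row j ?A = (\<Sum>i\<in>UNIV - {j}. (- const_mero (of_int (P $ i) / of_int (P $ j)) * var_mero j / var_mero i) *s row i ?A)"
  proof (rule vec_eq_iff[THEN iffD2, rule_format])
    fix k
    have "of_int (P $ j) * \<Lambda> k $ j + (\<Sum>i\<in>UNIV - {j}. of_int (P $ i) * \<Lambda> k $ i) = 0"
      using P[of k] by (simp add: pairing_def sum.remove[of UNIV j])
    then have "\<Lambda> k $ j = - ((\<Sum>i\<in>UNIV - {j}. of_int (P $ i) * \<Lambda> k $ i) / of_int (P $ j))"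
      using Pj by (simp add: field_simps eq_neg_iff_add_eq_0)
    moreover have "(\<Sum>i\<in>UNIV - {j}. - (of_int (P $ i) / of_int (P $ j)) * \<Lambda> k $ i)
        = - ((\<Sum>i\<in>UNIV - {j}. of_int (P $ i) * \<Lambda> k $ i) / of_int (P $ j))"
      by (simp add: sum_negf sum_divide_distrib)
    ultimately have "\<Lambda> k $ j = (\<Sum>i\<in>UNIV - {j}. - (of_int (P $ i) / of_int (P $ j)) * \<Lambda> k $ i)"
      by (simp only:)
    then have "row j ?A $ k = (\<Sum>i\<in>UNIV - {j}. const_mero (- (of_int (P $ i) / of_int (P $ j))) * const_mero (\<Lambda> k $ i)) * var_mero j"
      unfolding A by (simp only: const_mero_sum const_mero_mult)
    also have "\<dots> = (\<Sum>i\<in>UNIV - {j}. (- const_mero (of_int (P $ i) / of_int (P $ j)) * var_mero j / var_mero i) *s row i ?A) $ k"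
      unfolding sum_component sum_distrib_right vector_smult_component A
      by (rule sum.cong) (simp_all add: const_mero_minus)
    finally show "row j ?A $ k = (\<Sum>i\<in>UNIV - {j}. (- const_mero (of_int (P $ i) / of_int (P $ j)) * var_mero j / var_mero i) *s row i ?A) $ k" .
  qed
  also have "\<dots> \<in> V"
    unfolding V_def by (intro vec.span_sum vec.span_scale other[unfolded V_def]) auto
  finally have rows: "row i ?A \<in> V" for i using other by (cases "i = j") auto
  have "axis k 1 \<in> V" for k
  proof -
    have "axis k 1 = (\<Sum>i\<in>UNIV. (const_mero (L k $ i) / var_mero i) *s row i ?A)"
      unfolding vec_eq_iff
    proof
      fix l
      have "(\<Sum>i\<in>UNIV. (const_mero (L k $ i) / var_mero i) *s row i ?A) $ l
          = (\<Sum>i\<in>UNIV. const_mero (L k $ i) / var_mero i * to_mero_vec (diag_vf (\<Lambda> l)) $ i)"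
        by (simp add: sum_component A to_mero_vec_diag)
      then show "axis k 1 $ l = (\<Sum>i\<in>UNIV. (const_mero (L k $ i) / var_mero i) *s row i ?A) $ l"
        unfolding left_inverse_mero[OF L] by (simp add: axis_def)
    qed
    also have "\<dots> \<in> V"
      unfolding V_def by (intro vec.span_sum vec.span_scale rows[unfolded V_def])
    finally show ?thesis .
  qed
  then have "vec.span cart_basis \<subseteq> V"
    unfolding V_def by (intro vec.span_minimal) (auto simp: cart_basis_def)
  then have "CARD('r) \<le> vec.dim V"
    using vec.dim_subset[of UNIV V] unfolding span_cart_basis vec_dim_card by simp
  then show False using exc by (simp add: exceptional_index_def V_def)
qed



section \<open>Power series coefficients of the torus fields\<close>

text \<open>
  The gradients of the first integrals span a space of dimension at least \<open>n - r\<close> that is orthogonal to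
  the fields \<open>\<Lambda> j \<odot> x\<close>, which already have dimension \<open>r\<close>, and to \<open>G\<close>. There is no room for \<open>G\<close> outside
  their span.
\<close>

lemma integrable_in_torus_span:
  fixes lam :: "(complex, 'n::{finite,linorder}) vec"
    and \<Lambda> :: "'r::finite \<Rightarrow> (complex, 'n) vec"
  assumes G: "poincare_dulac_normal_form lam G"
    and integrable: "maximal_meromorphic_integrable lam G"
    and rank: "CARD('n) - CARD('r) \<le> lattice_rank (R_bar lam)"
    and \<Lambda>: "inj \<Lambda>" "vec.independent (range \<Lambda>)"
    and iso: "rational_isoresonant lam \<Lambda>"
  shows "\<exists>s. to_mero_vec G = (\<Sum>j\<in>UNIV. s j *s to_mero_vec (diag_vf (\<Lambda> j)))"
proof -
  let ?u = "\<lambda>j. to_mero_vec (diag_vf (\<Lambda> j)) :: ('n meromorphic, 'n) vec" and ?d = "lattice_rank (R_bar lam)"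
  obtain \<psi> where \<psi>: "\<And>k. k \<in> {1..?d} \<Longrightarrow> first_integral G (\<psi> k)" "independent_functions ?d \<psi>"
    using integrable unfolding maximal_meromorphic_integrable_def by blast
  let ?D = "(\<lambda>k. mero_gradient (\<psi> k)) ` {1..?d}"
  have orth: "(\<Sum>i\<in>UNIV. v $ i * u $ i) = 0" if "u \<in> insert (to_mero_vec G) (range ?u)" "v \<in> ?D" for u v
  proof -
    obtain k where k: "k \<in> {1..?d}" "v = mero_gradient (\<psi> k)" using \<open>v \<in> ?D\<close> by blast
    have "first_integral (diag_vf (\<Lambda> j)) (\<psi> k)" for j
      by (rule first_integral_torus[OF G _ \<psi>(1)[OF k(1)]]) (use iso in \<open>auto simp: rational_isoresonant_def\<close>)
    then show ?thesis using that(1) \<psi>(1)[OF k(1)] k(2)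
      by (auto simp: first_integral_def to_mero_vec_def)
  qed
  have "vec.dim (insert (to_mero_vec G) (range ?u)) + vec.dim ?D \<le> CARD('n)"
    by (rule dim_orthogonal_le) (rule orth)
  then have "vec.dim (insert (to_mero_vec G) (range ?u)) + ?d \<le> CARD('n)"
    using \<psi>(2) unfolding independent_functions_def by (simp only:)
  then have "vec.dim (insert (to_mero_vec G) (range ?u)) \<le> CARD('r)"
    using rank by linarith
  then have "to_mero_vec G \<in> vec.span (range ?u)"
    using dim_torus_fields[OF \<Lambda>] by (auto simp: vec.dim_insert split: if_splits)
  then obtain t where "to_mero_vec G = (\<Sum>v\<in>range ?u. t v *s v)"
    by (auto simp: vec.span_finite)
  moreover have "inj ?u"
    by (rule inj_torus_fields[OF \<Lambda>])
  ultimately have eq: "to_mero_vec G = (\<Sum>j\<in>UNIV. t (?u j) *s ?u j)"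
    by (simp add: sum.reindex)
  show ?thesis by (rule exI[of _ "\<lambda>j. t (?u j)"]) (rule eq)
qed

lemma mfps_const_sum:
  "mfps_const (\<Sum>i\<in>I. c i) = (\<Sum>i\<in>I. mfps_const (c i) :: (complex, 'n::finite) mfps)"
  by (induction I rule: infinite_finite_induct) (simp_all add: mfps_const_0 mfps_const_add)

text \<open>
  Let \<open>prj = \<Lambda> L\<close> be the projection onto the complex span of the \<open>\<Lambda> j\<close> given by a left inverse \<open>L\<close>. It
  fixes the vector with entries \<open>G\<^sub>i / x\<^sub>i\<close>. To compare coefficients, this identity is multiplied by the
  product \<open>X\<close> of all variables, which turns \<open>G\<^sub>i / x\<^sub>i\<close> into the power series \<open>F i\<close>.
\<close>

lemma power_series_torus_representation:
  fixes lam :: "(complex, 'n::{finite,linorder}) vec"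
    and \<Lambda> :: "'r::finite \<Rightarrow> (complex, 'n) vec"
  assumes G: "poincare_dulac_normal_form lam G"
    and \<Lambda>: "inj \<Lambda>" "vec.independent (range \<Lambda>)"
    and iso: "rational_isoresonant lam \<Lambda>"
    and lam: "lam = (\<Sum>j\<in>UNIV. \<gamma> j *s \<Lambda> j)"
    and span: "to_mero_vec G = (\<Sum>j\<in>UNIV. s j *s to_mero_vec (diag_vf (\<Lambda> j)))"
  shows "\<exists>s :: 'r \<Rightarrow> (complex, 'n) mfps.
        (\<forall>i P. mfps_nth (s i) P \<noteq> 0 \<longrightarrow> P \<in> M_res_nonneg lam) \<and>
        (\<forall>i. mfps_nth (s i) 0 = 0) \<and>
        G = (\<Sum>i\<in>UNIV. (mfps_const (\<gamma> i) + s i) *s diag_vf (\<Lambda> i))"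
proof -
  obtain L :: "'r \<Rightarrow> (complex, 'n) vec"
    where L: "\<And>j k. (\<Sum>i\<in>UNIV. L j $ i * \<Lambda> k $ i) = (if j = k then 1 else 0)"
    using independent_family_left_inverse[OF \<Lambda>] by blast
  define prj where "prj i k = (\<Sum>j\<in>UNIV. \<Lambda> j $ i * L j $ k)" for i k
  define co :: "'n \<Rightarrow> (nat, 'n) vec" where "co i = (\<chi> k. if k = i then 0 else 1)" for i
  define X :: "(complex, 'n) mfps" where "X = monomial (\<chi> k. 1)"
  define F where "F i = monomial (co i) * G $ i" for i
  have X: "X = mfps_var i * monomial (co i)" for i
    unfolding X_def mfps_var_eq_monomial monomial_mult
    by (rule arg_cong[of _ _ monomial]) (simp add: co_def vec_eq_iff axis_def)
  have G_i: "to_fract (G $ i) = (\<Sum>j\<in>UNIV. s j * const_mero (\<Lambda> j $ i)) * var_mero i" for i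
    using arg_cong[OF span, of "\<lambda>v. v $ i"]
    by (simp add: to_mero_vec_diag sum_distrib_right mult.assoc) (simp add: to_mero_vec_def)
  have F_mero: "to_fract (F i) = to_fract X * (\<Sum>j\<in>UNIV. s j * const_mero (\<Lambda> j $ i))" for i
    unfolding X[of i] F_def to_fract_mult G_i var_mero_def[symmetric] by (simp add: mult_ac)
  have s: "s j = (\<Sum>k\<in>UNIV. const_mero (L j $ k) * (\<Sum>l\<in>UNIV. s l * const_mero (\<Lambda> l $ k)))" for j
  proof -
    have "(\<Sum>k\<in>UNIV. const_mero (L j $ k) * (\<Sum>l\<in>UNIV. s l * const_mero (\<Lambda> l $ k)))
        = (\<Sum>l\<in>UNIV. s l * const_mero (\<Sum>k\<in>UNIV. L j $ k * \<Lambda> l $ k))"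
      unfolding const_mero_sum const_mero_mult sum_distrib_left
      by (subst sum.swap) (simp add: mult_ac)
    also have "\<dots> = (\<Sum>l\<in>UNIV. if j = l then s l else 0)"
      unfolding L by (rule sum.cong) auto
    finally show ?thesis by simp
  qed
  have proj_mero: "to_fract (F i) = (\<Sum>k\<in>UNIV. const_mero (prj i k) * to_fract (F k))" for i
  proof -
    have "to_fract (F i) = (\<Sum>j\<in>UNIV. \<Sum>k\<in>UNIV. const_mero (\<Lambda> j $ i * L j $ k) * to_fract (F k))"
      unfolding F_mero[of i] sum_distrib_left
    proof (rule sum.cong[OF refl])
      fix j
      have "to_fract X * (s j * const_mero (\<Lambda> j $ i))
          = const_mero (\<Lambda> j $ i) * (\<Sum>k\<in>UNIV. const_mero (L j $ k) * to_fract (F k))"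
        by (subst s) (simp add: F_mero sum_distrib_left sum_distrib_right mult_ac)
      then show "to_fract X * (s j * const_mero (\<Lambda> j $ i))
          = (\<Sum>k\<in>UNIV. const_mero (\<Lambda> j $ i * L j $ k) * to_fract (F k))"
        by (simp add: const_mero_mult sum_distrib_left mult.assoc)
    qed
    then show ?thesis
      unfolding prj_def const_mero_sum sum_distrib_right by (subst sum.swap)
  qed
  have to_fract_sum: "to_fract (\<Sum>k\<in>I. h k) = (\<Sum>k\<in>I. to_fract (h k))" for h :: "'n \<Rightarrow> (complex, 'n) mfps" and I
    by (induction I rule: infinite_finite_induct) simp_all
  have F_proj: "F i = (\<Sum>k\<in>UNIV. mfps_const (prj i k) * F k)" for i
    using proj_mero[of i] unfolding const_mero_def to_fract_mult[symmetric] to_fract_sum[symmetric]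
      to_fract_eq_iff .
  have proj: "mfps_nth (F i) R = (\<Sum>k\<in>UNIV. prj i k * mfps_nth (F k) R)" for i R
    by (subst F_proj[of i]) (simp add: mfps_nth_sum)

  (* A term of G_i without x_i would put the i-th unit vector into the range of prj,
     orthogonal to the resonance P - e_i, whose i-th entry is -1. *)
  have no_pole: "mfps_nth (G $ i) P = 0" if "P $ i = 0" for i P
  proof (rule ccontr)
    assume nz: "mfps_nth (G $ i) P \<noteq> 0"
    define c where "c = mfps_nth (F i) (co i + P)"
    have "c \<noteq> 0" using nz by (simp add: c_def F_def)
    have "mfps_nth (F k) (co i + P) = 0" if "k \<noteq> i" for k
      unfolding F_def
    proof (rule mfps_nth_monomial_mult_eq_0)
      have "\<not> co k $ i \<le> (co i + P) $ i" using that \<open>P $ i = 0\<close> by (simp add: co_def)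
      then show "\<not> (\<forall>l. co k $ l \<le> (co i + P) $ l)" by blast
    qed
    then have Fk: "mfps_nth (F k) (co i + P) = (if k = i then c else 0)" for k by (simp add: c_def)
    have prj: "prj l i = (if l = i then 1 else 0)" for l
    proof -
      have "(if l = i then c else 0) = (\<Sum>k\<in>UNIV. prj l k * (if k = i then c else 0))"
        using proj[of l "co i + P"] unfolding Fk .
      also have "\<dots> = (\<Sum>k\<in>UNIV. if k = i then prj l i * c else 0)" by (rule sum.cong) auto
      finally show ?thesis using \<open>c \<noteq> 0\<close> by (auto split: if_splits)
    qed
    have w: "weight (\<Lambda> j) P = \<Lambda> j $ i" for j
      by (rule normal_form_coeff_weight[OF G _ nz]) (use iso in \<open>auto simp: rational_isoresonant_def\<close>)
    have "(\<Sum>l\<in>UNIV. of_nat (P $ l) * prj l i) = (\<Sum>j\<in>UNIV. weight (\<Lambda> j) P * L j $ i)"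
      unfolding prj_def weight_def sum_distrib_left sum_distrib_right by (subst sum.swap) (simp add: mult.assoc)
    also have "\<dots> = prj i i" by (simp add: w prj_def)
    also have "\<dots> = 1" by (simp add: prj)
    finally have "(\<Sum>l\<in>UNIV. of_nat (P $ l) * prj l i) = 1" .
    moreover have "of_nat (P $ l) * prj l i = 0" for l using that by (simp add: prj)
    ultimately show False by simp
  qed

  define h where "h i = (Abs_mfps (\<lambda>P. mfps_nth (G $ i) (axis i 1 + P)) :: (complex, 'n) mfps)" for i
  have h_nth: "mfps_nth (h i) P = mfps_nth (F i) ((\<chi> k. 1) + P)" for i P
  proof -
    have "(\<chi> k. 1) + P = co i + (axis i 1 + P)" by (simp add: vec_eq_iff co_def axis_def)
    then show ?thesis by (simp add: h_def F_def)
  qed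
  have G_h: "G $ i = mfps_var i * h i" for i
  proof (rule mfps_eqI)
    fix P
    show "mfps_nth (G $ i) P = mfps_nth (mfps_var i * h i) P"
    proof (cases "\<forall>k. (axis i 1 :: (nat, 'n) vec) $ k \<le> P $ k")
      case True
      then obtain C where "P = axis i 1 + C" by (rule vec_nat_le_ex)
      then show ?thesis by (simp add: mfps_var_eq_monomial h_def del: One_nat_def)
    next
      case False
      then have "P $ i = 0" by (auto simp: axis_def split: if_splits)
      with False show ?thesis by (simp add: mfps_var_eq_monomial mfps_nth_monomial_mult_eq_0 no_pole)
    qed
  qed
  have h_proj: "h i = (\<Sum>k\<in>UNIV. mfps_const (prj i k) * h k)" for i
    by (rule mfps_eqI) (simp add: h_nth mfps_nth_sum proj[of i])
  have h_weight: "weight lam P = 0" if "mfps_nth (h i) P \<noteq> 0" for i P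
  proof -
    have "weight lam (axis i 1 + P) = lam $ i"
      by (rule normal_form_coeff_weight[OF G]) (use that in \<open>auto simp: h_def\<close>)
    then show ?thesis by (simp add: weight_add weight_axis del: One_nat_def)
  qed
  define S where "S j = (\<Sum>i\<in>UNIV. mfps_const (L j $ i) * h i)" for j
  have S_weight: "weight lam P = 0" if "mfps_nth (S j) P \<noteq> 0" for j P
  proof -
    from that obtain i where "L j $ i * mfps_nth (h i) P \<noteq> 0"
      unfolding S_def mfps_nth_sum mfps_nth_const_mult by (meson sum.neutral)
    then show ?thesis using h_weight by auto
  qed
  have S0: "mfps_nth (S j) 0 = \<gamma> j" for j
  proof -
    have "mfps_nth (S j) 0 = (\<Sum>i\<in>UNIV. L j $ i * lam $ i)"
      using normal_form_coeff_axis[OF G] by (simp add: S_def mfps_nth_sum h_def)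
    also have "\<dots> = (\<Sum>k\<in>UNIV. \<gamma> k * (\<Sum>i\<in>UNIV. L j $ i * \<Lambda> k $ i))"
      unfolding lam sum_component vector_smult_component sum_distrib_left
      by (subst sum.swap) (simp add: mult_ac)
    also have "\<dots> = (\<Sum>k\<in>UNIV. if j = k then \<gamma> k else 0)"
      unfolding L by (rule sum.cong) auto
    finally show ?thesis by simp
  qed
  have G_S: "G = (\<Sum>j\<in>UNIV. S j *s diag_vf (\<Lambda> j))"
    unfolding vec_eq_iff
  proof
    fix i
    have "(\<Sum>j\<in>UNIV. S j *s diag_vf (\<Lambda> j)) $ i
        = (\<Sum>j\<in>UNIV. \<Sum>k\<in>UNIV. mfps_var i * (mfps_const (\<Lambda> j $ i * L j $ k) * h k))"
      by (simp add: S_def diag_vf_def sum_component sum_distrib_left sum_distrib_right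
          mfps_const_mult_const mult_ac)
    also have "\<dots> = mfps_var i * (\<Sum>k\<in>UNIV. mfps_const (prj i k) * h k)"
      unfolding prj_def mfps_const_sum sum_distrib_left sum_distrib_right by (rule sum.swap)
    also have "\<dots> = G $ i" unfolding h_proj[symmetric] G_h ..
    finally show "G $ i = (\<Sum>j\<in>UNIV. S j *s diag_vf (\<Lambda> j)) $ i" ..
  qed
  let ?s = "\<lambda>j. S j - mfps_const (\<gamma> j)"
  show ?thesis
  proof (intro exI[of _ ?s] conjI allI impI)
    fix i
    show "mfps_nth (?s i) 0 = 0" by (simp add: minus_mfps.rep_eq mfps_const.rep_eq S0)
    fix P assume "mfps_nth (?s i) P \<noteq> 0"
    then have "mfps_nth (S i) P \<noteq> 0"
      using S0[of i] by (auto simp: minus_mfps.rep_eq mfps_const.rep_eq split: if_splits)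
    then have "weight lam P = 0" by (rule S_weight)
    then show "P \<in> M_res_nonneg lam" by (simp add: M_res_nonneg_def pairing_def weight_def)
  next
    have "mfps_const (\<gamma> i) + ?s i = S i" for i by simp
    then show "G = (\<Sum>i\<in>UNIV. (mfps_const (\<gamma> i) + ?s i) *s diag_vf (\<Lambda> i))"
      by (simp only: G_S[symmetric])
  qed
qed

section \<open>Integrable normal forms and exceptional indices\<close>

theorem proposition85:
  fixes lam :: "(complex, 'n::{finite,linorder}) vec"
    and G :: "((complex, 'n) mfps, 'n) vec"
    and Q :: "nat \<Rightarrow> (int, 'n) vec"
    and \<Lambda> :: "'r::finite \<Rightarrow> (complex, 'n) vec"
    and \<gamma> :: "'r \<Rightarrow> complex"
  assumes nonzero: "lam \<noteq> 0"
    and normal_form: "poincare_dulac_normal_form lam G"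
    and integrable: "maximal_meromorphic_integrable lam G"
    and Q_inj: "inj_on Q {1..CARD('n) - CARD('r)}"
    and Q_indep: "zvec.independent (Q ` {1..CARD('n) - CARD('r)})"
    and Q_span: "zvec.span (Q ` {1..CARD('n) - CARD('r)}) = R_bar lam"
    and \<Lambda>_inj: "inj \<Lambda>"
    and \<Lambda>_indep: "vec.independent (range \<Lambda>)"
    and orthogonal: "\<And>i j. i \<in> {1..CARD('n) - CARD('r)} \<Longrightarrow> pairing (Q i) (\<Lambda> j) = 0"
    and decomposition: "lam = (\<Sum>j\<in>UNIV. \<gamma> j *s \<Lambda> j)"
  shows
    "rational_isoresonant lam \<Lambda> \<and>
     (\<exists>s. to_mero_vec G = (\<Sum>j\<in>UNIV. s j *s to_mero_vec (diag_vf (\<Lambda> j)))) \<and>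
     (\<forall>j. exceptional_index \<Lambda> j \<longrightarrow>
        (\<forall>i\<in>{1..CARD('n) - CARD('r)}. Q i $ j = 0) \<and>
        (\<forall>P. first_integral G (laurent_monomial P) \<longrightarrow> mero_free_of j (laurent_monomial P)) \<and>
        (\<forall>\<psi>. first_integral G \<psi> \<longrightarrow> mero_free_of j \<psi>)) \<and>
     (\<exists>s :: 'r \<Rightarrow> (complex, 'n) mfps.
        (\<forall>i P. mfps_nth (s i) P \<noteq> 0 \<longrightarrow> P \<in> M_res_nonneg lam) \<and>
        (\<forall>i. mfps_nth (s i) 0 = 0) \<and>
        G = (\<Sum>i\<in>UNIV. (mfps_const (\<gamma> i) + s i) *s diag_vf (\<Lambda> i)))"
proof -
  let ?Q = "Q ` {1..CARD('n) - CARD('r)}"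
  have "pairing P (\<Lambda> j) = 0" if "P \<in> zvec.span ?Q" for P j
    using that
  proof (induction rule: zvec.span_induct_alt)
    case base
    then show ?case by (simp add: pairing_def)
  next
    case (step c b P)
    have "pairing (c *s b + P) (\<Lambda> j) = of_int c * pairing b (\<Lambda> j) + pairing P (\<Lambda> j)"
      by (simp add: pairing_def algebra_simps sum.distrib sum_distrib_left)
    moreover have "pairing b (\<Lambda> j) = 0" using step(1) orthogonal by auto
    ultimately show ?case using step(2) by simp
  qed
  then have iso: "rational_isoresonant lam \<Lambda>"
    unfolding rational_isoresonant_def Q_span by (simp add: R_bar_def)
  have "?Q \<subseteq> R_bar lam" unfolding Q_span[symmetric] by (rule zvec.span_superset)
  from card_le_lattice_rank[OF this Q_indep]
  have rank: "CARD('n) - CARD('r) \<le> lattice_rank (R_bar lam)"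
    using card_image[OF Q_inj] by simp
  obtain s where s: "to_mero_vec G = (\<Sum>j\<in>UNIV. s j *s to_mero_vec (diag_vf (\<Lambda> j)))"
    using integrable_in_torus_span[OF normal_form integrable rank \<Lambda>_inj \<Lambda>_indep iso] by blast
  have exc: "P $ j = 0" if "exceptional_index \<Lambda> j" "pairing P lam = 0" for j P
    using exceptional_index_exponent_0[OF \<Lambda>_inj \<Lambda>_indep that(1), of P] iso that(2)
    by (simp add: rational_isoresonant_def)
  have free: "mero_free_of j \<psi>" if "exceptional_index \<Lambda> j" "first_integral G \<psi>" for j \<psi>
  proof (rule Euler_invariant_mero_free_of, rule first_integral_torus[OF normal_form _ that(2)])
    fix P assume "pairing P lam = 0"
    then have "P $ j = 0" by (rule exc[OF that(1)])
    then have "of_int (P $ i) * (axis j 1 :: (complex, 'n) vec) $ i = 0" for i by (simp add: axis_def)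
    then show "pairing P (axis j 1) = 0" unfolding pairing_def by (intro sum.neutral) blast
  qed
  have Q0: "Q i $ j = 0" if "exceptional_index \<Lambda> j" "i \<in> {1..CARD('n) - CARD('r)}" for i j
    using exc[OF that(1), of "Q i"] \<open>?Q \<subseteq> R_bar lam\<close> that(2) unfolding R_bar_def by blast
  show ?thesis
  proof (intro conjI allI impI ballI)
    show "\<exists>s. to_mero_vec G = (\<Sum>j\<in>UNIV. s j *s to_mero_vec (diag_vf (\<Lambda> j)))"
      by (rule exI[of _ s]) (rule s)
    show "\<exists>s :: 'r \<Rightarrow> (complex, 'n) mfps.
        (\<forall>i P. mfps_nth (s i) P \<noteq> 0 \<longrightarrow> P \<in> M_res_nonneg lam) \<and>
        (\<forall>i. mfps_nth (s i) 0 = 0) \<and>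
        G = (\<Sum>i\<in>UNIV. (mfps_const (\<gamma> i) + s i) *s diag_vf (\<Lambda> i))"
      by (rule power_series_torus_representation[OF normal_form \<Lambda>_inj \<Lambda>_indep iso decomposition s])
  qed (fact iso, (rule Q0 free; assumption)+)
qed

end
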